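(* Let $P$ be any probability distribution over $\mathbb{R}$ with cumulative distribution function $F$, let $(X_t)_{t\ge1}$ be i.i.d. from $P$, and let $F_t(x)=\frac1t\sum_{i=1}^tI(X_i\le x)$ be the empirical CDF. Let $\ell:[0,\infty)\to[1,\infty)$ be a function such that $\sum_{k=1}^\infty1/\ell(k)\le1$, $\ell(x)=\ell(1)$ for all $x\in[0,1]$, and $u\mapsto2^{-u}\log\ell(u)$ is decreasing (not necessarily strictly) on $[1,\infty)$. Then for any $\delta\in(0,1)$, $$\mathbb{P}\left(\exists t\ge1:\|F_t-F\|_\infty\ge\sqrt{\frac{\pi}{t}}+2\sqrt{\frac2t\Big[\log\ell(\log_2t)+\log(1/\delta)\Big]}\right)\le\delta.$$
   Context: $\|F_t-F\|_\infty=\sup_{x\in\mathbb{R}}|F_t(x)-F(x)|$; $t$ ranges over positive integers; $\log$ is the natural logarithm. *)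

theory Defs
  imports "HOL-Probability.Probability"
begin

definition ecdf :: "(nat \<Rightarrow> 'a \<Rightarrow> real) \<Rightarrow> nat \<Rightarrow> 'a \<Rightarrow> real \<Rightarrow> real" where
  "ecdf X t \<omega> x = (1 / real t) * (\<Sum>i=1..t. indicator {..x} (X i \<omega>))"

(* The supremum is the conditionally complete one on real; it is the intended
   supremum only for bounded f, which holds for differences of distribution functions. *)
definition sup_norm :: "(real \<Rightarrow> real) \<Rightarrow> real" where
  "sup_norm f = (SUP x. \<bar>f x\<bar>)"

lemma ecdf_ge_0: "0 \<le> ecdf X t \<omega> x"
  unfolding ecdf_def by (intro mult_nonneg_nonneg sum_nonneg) auto

lemma ecdf_le_1: "ecdf X t \<omega> x \<le> 1"
proof (cases "t = 0")
  case False
  have "(\<Sum>i=1..t. indicator {..x} (X i \<omega>) :: real) \<le> (\<Sum>i=1..t. 1)"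
    by (intro sum_mono) (auto simp: indicator_def)
  then show ?thesis using False by (simp add: ecdf_def field_simps)
qed (simp add: ecdf_def)

lemma abs_ecdf_diff_cdf_le_1:
  assumes "real_distribution P"
  shows "\<bar>ecdf X t \<omega> x - cdf P x\<bar> \<le> 1"
proof -
  interpret P: real_distribution P by fact
  show ?thesis
    using ecdf_ge_0[of X t \<omega> x] ecdf_le_1[of X t \<omega> x]
      P.cdf_nonneg[of x] P.cdf_bounded_prob[of x]
    by linarith
qed

lemma bdd_above_abs_ecdf_diff_cdf:
  assumes "real_distribution P"
  shows "bdd_above ((\<lambda>x. \<bar>ecdf X t \<omega> x - cdf P x\<bar>) ` A)"
  using abs_ecdf_diff_cdf_le_1[OF assms] by (intro bdd_aboveI[of _ 1]) auto

lemma indicator_atMost_right_cont: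
  "continuous (at_right a) (\<lambda>x. indicator {..x} (y::real) :: real)"
proof -
  have "eventually (\<lambda>x. (indicator {..x} y :: real) = indicator {..a} y) (at_right a)"
  proof (cases "y \<le> a")
    case True
    then show ?thesis
      using eventually_at_right_less[of a] by (auto simp: indicator_def elim: eventually_mono)
  next
    case False
    then have "eventually (\<lambda>x. x < y) (at_right a)"
      by (intro order_tendstoD(2)[OF tendsto_ident_at]) auto
    then show ?thesis using False by (auto simp: indicator_def elim: eventually_mono)
  qed
  then show ?thesis
    unfolding continuous_within by (rule tendsto_eventually)
qed

lemma sup_norm_eq_SUP_Rats:
  assumes "real_distribution P"
  shows "sup_norm (\<lambda>x. ecdf X t \<omega> x - cdf P x) = (SUP x\<in>\<rat>. \<bar>ecdf X t \<omega> x - cdf P x\<bar>)"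
    (is "sup_norm ?f = ?R")
proof (rule antisym)
  interpret P: real_distribution P by fact
  show "sup_norm ?f \<le> ?R"
    unfolding sup_norm_def
  proof (rule cSUP_least)
    fix a :: real
    have "continuous (at_right a) (\<lambda>x. \<bar>?f x\<bar>)"
      unfolding ecdf_def
      by (intro continuous_intros indicator_atMost_right_cont P.cdf_is_right_cont)
    then have lim: "((\<lambda>x. \<bar>?f x\<bar>) \<longlongrightarrow> \<bar>?f a\<bar>) (at_right a)"
      by (simp add: continuous_within)
    show "\<bar>?f a\<bar> \<le> ?R"
    proof (rule ccontr)
      assume "\<not> ?thesis"
      then have "eventually (\<lambda>x. ?R < \<bar>?f x\<bar>) (at_right a)"
        by (intro order_tendstoD(1)[OF lim]) auto
      then obtain b where b: "b > a" "\<And>x. a < x \<Longrightarrow> x < b \<Longrightarrow> ?R < \<bar>?f x\<bar>"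
        by (auto simp: eventually_at_right_field)
      obtain q where q: "q \<in> \<rat>" "a < q" "q < b"
        using Rats_dense_in_real[OF b(1)] by auto
      have "\<bar>?f q\<bar> \<le> ?R"
        by (rule cSUP_upper[OF q(1) bdd_above_abs_ecdf_diff_cdf[OF assms]])
      then show False using b(2)[OF q(2,3)] by simp
    qed
  qed simp
  show "?R \<le> sup_norm ?f"
    unfolding sup_norm_def
    by (rule cSUP_subset_mono) (use bdd_above_abs_ecdf_diff_cdf[OF assms] Rats_0 in auto)
qed

lemma borel_measurable_sup_norm_ecdf [measurable]:
  assumes "real_distribution P" and "\<And>i. i \<in> {1..t} \<Longrightarrow> X i \<in> borel_measurable M"
  shows "(\<lambda>\<omega>. sup_norm (\<lambda>x. ecdf X t \<omega> x - cdf P x)) \<in> borel_measurable M"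
proof -
  have "(\<lambda>\<omega>. ecdf X t \<omega> x) \<in> borel_measurable M" for x
    unfolding ecdf_def
    by (intro borel_measurable_times borel_measurable_const borel_measurable_sum
        measurable_compose[OF assms(2)]) auto
  then have "(\<lambda>\<omega>. SUP x\<in>\<rat>. \<bar>ecdf X t \<omega> x - cdf P x\<bar>) \<in> borel_measurable M"
    by (intro borel_measurable_cSUP countable_rat bdd_above_abs_ecdf_diff_cdf[OF assms(1)]) auto
  then show ?thesis by (simp add: sup_norm_eq_SUP_Rats[OF assms(1)])
qed

(* So the measure of such an event is never merely the default value 0 that
   measure assigns to non-measurable sets. *)
lemma sets_ex_ecdf_deviation:
  assumes "real_distribution P" and "\<And>i. i \<in> {1..} \<Longrightarrow> X i \<in> borel_measurable M"
  shows "{\<omega> \<in> space M. \<exists>t\<ge>1. sup_norm (\<lambda>x. ecdf X t \<omega> x - cdf P x) \<ge> c t} \<in> sets M"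
proof -
  have "(\<lambda>\<omega>. sup_norm (\<lambda>x. ecdf X t \<omega> x - cdf P x)) \<in> borel_measurable M" for t
    by (rule borel_measurable_sup_norm_ecdf[OF assms(1)]) (use assms(2) in auto)
  then show ?thesis by measurable
qed

end

theory Submission
  imports Defs
begin

text \<open>
  The times are split into the epochs $2^j \le t < 2^{j+1}$; by monotonicity of
  $u \mapsto 2^{-u} \log \ell(u)$ it suffices to bound the probability of an exceedance in
  epoch $j$ by $\delta / \ell(j+1)$.  With $n = 2^{j+1}$, a first-exceedance decomposition
  combined with the ghost sample $X_{n+1}, \dots, X_{2n}$ bounds the running maximum of
  $t \sup_x (F_t(x) - F(x))$, $t \le n$, by the exponential moment of the two-sample statistic
  $\max_x \sum_{i \le n} (I(X_i \le x) - I(X_{n+i} \le x))$.  By exchangeability the latter is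
  governed by the maximum of a uniformly random bridge of length $2n$, whose tail
  $\binom{2n}{n+m} / \binom{2n}{n}$ is the ballot count.  The resulting bound is smaller than
  required as soon as $\log \ell(j+1) + \log (1/\delta) \ge 0.43$, and the hypotheses on
  $\ell$ force $\log \ell(k) \ge 0.43$ for all integers $k \ge 1$.
\<close>

section \<open>The ballot count for chains of sets\<close>

text \<open>The height, after the steps in \<open>I\<close>, of the walk that goes up at members of
  \<open>A\<close> and down elsewhere. With \<open>A\<close> the labels of the first sample it
  becomes the two-sample difference of counts.\<close>

definition net :: "'i set \<Rightarrow> 'i set \<Rightarrow> int" where
  "net A I = (\<Sum>i\<in>I. if i \<in> A then 1 else - 1)"

lemma net_insert: "finite I \<Longrightarrow> i \<notin> I \<Longrightarrow> net A (insert i I) = (if i \<in> A then 1 else - 1) + net A I"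
  by (simp add: net_def)

lemma net_cong: "(\<And>i. i \<in> I \<Longrightarrow> i \<in> A \<longleftrightarrow> i \<in> B) \<Longrightarrow> net A I = net B I"
  unfolding net_def by (intro sum.cong) auto

text \<open>Condition on the first step: an up step leaves level m - 1 and p - 1 up steps, a down
  step leaves level m + 1 and p up steps, and Pascal's rule adds the two binomials. This replaces
  the reflection argument.\<close>

lemma card_net_take_ge:
  fixes m p :: nat
  assumes "distinct xs"
  shows "card {A. A \<subseteq> set xs \<and> card A = p \<and> (\<exists>k. int m \<le> net A (set (take k xs)))}
    \<le> length xs choose (length xs + m - p)"
  using assms
proof (induction xs arbitrary: m p)
  case Nil
  show ?case
  proof (cases "m = 0 \<and> p = 0")
    case True
    have "{A. A \<subseteq> set [] \<and> card A = p \<and> (\<exists>k. int m \<le> net A (set (take k [])))} \<subseteq> {{}}"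
      by auto
    from card_mono[OF _ this] True show ?thesis by simp
  next
    case False
    then have "{A. A \<subseteq> set [] \<and> card A = p \<and> (\<exists>k. int m \<le> net A (set (take k [])))} = {}"
      by (auto simp: net_def)
    then show ?thesis by (metis card.empty le0)
  qed
next
  case (Cons x xs)
  let ?h = "\<lambda>xs p m. {A. A \<subseteq> set xs \<and> card A = p \<and> (\<exists>k. int m \<le> net A (set (take k xs)))}"
  let ?N = "length xs"
  have fin: "finite (?h xs p m)" for xs p m
    by (rule finite_subset[of _ "Pow (set xs)"]) auto
  show ?case
  \<comment> \<open>For larger \<open>p\<close> there is no such set. The case is split off because
    the Pascal step needs the natural-number difference \<open>?N + m - p\<close> to be a genuine
    one.\<close>
  proof (cases "p \<le> Suc ?N")
    case False
    have "?h (x # xs) p m = {}"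
    proof -
      have "card A \<le> Suc ?N" if "A \<subseteq> set (x # xs)" for A
        using card_mono[OF _ that] card_length[of "x # xs"] by simp
      then show ?thesis using False by auto
    qed
    then show ?thesis by (metis card.empty le0)
  next
    case p: True
    show ?thesis
    proof (cases m)
      case 0
      have "card (?h (x # xs) p m) \<le> card {A. A \<subseteq> set (x # xs) \<and> card A = p}"
        by (rule card_mono) auto
      also have "\<dots> = Suc ?N choose p"
        using n_subsets[of "set (x # xs)" p] distinct_card[OF Cons.prems] by simp
      also have "\<dots> = Suc ?N choose (Suc ?N - p)"
        by (rule binomial_symmetric) (use p in simp)
      finally show ?thesis using 0 by simp
    next
      case (Suc m')
      \<comment> \<open>The sets containing \<open>x\<close>, coded by what remains of them. At p =
        0 there are none, whereas the truncated \<open>p - 1\<close> would be 0 again; hence the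
        guard.\<close>
      let ?P = "if p = 0 then {} else insert x ` ?h xs (p - 1) m'"
      have x: "x \<notin> set xs" using Cons.prems by simp
      have sub: "?h (x # xs) p m \<subseteq> ?P \<union> ?h xs p (Suc m)"
      proof
        fix A assume "A \<in> ?h (x # xs) p m"
        then obtain k where A: "A \<subseteq> set (x # xs)" "card A = p"
          and k: "int m \<le> net A (set (take k (x # xs)))" by auto
        have finA: "finite A" using A(1) finite_subset by auto
        \<comment> \<open>A level m >= 1 is not reached by the empty prefix.\<close>
        obtain k' where k': "k = Suc k'"
          using k Suc by (cases k) (auto simp: net_def)
        have xk: "x \<notin> set (take k' xs)" using x by (meson in_set_takeD)
        have k2: "int m \<le> (if x \<in> A then 1 else - 1) + net A (set (take k' xs))"
          using k xk by (simp add: k' net_insert)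
        show "A \<in> ?P \<union> ?h xs p (Suc m)"
        proof (cases "x \<in> A")
          case True
          have "net A (set (take k' xs)) = net (A - {x}) (set (take k' xs))"
            by (rule net_cong) (use xk in auto)
          then have "A - {x} \<in> ?h xs (p - 1) m'"
            using A k2 True Suc finA by (auto intro!: exI[of _ k'])
          moreover have "p \<noteq> 0" using True A finA card_0_eq by blast
          ultimately show ?thesis
            using insert_Diff[OF True] by (auto intro!: image_eqI[of _ _ "A - {x}"])
        next
          case False
          then have "A \<in> ?h xs p (Suc m)"
            using A k2 by (auto intro!: exI[of _ k'])
          then show ?thesis by simp
        qed
      qed
      have P: "card ?P \<le> ?N choose (?N + m - p)"
      proof (cases "p = 0")
        case False
        have "card ?P \<le> card (?h xs (p - 1) m')"
          using False card_image_le[OF fin] by simp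
        also have "\<dots> \<le> ?N choose (?N + m' - (p - 1))"
          using Cons by simp
        also have "?N + m' - (p - 1) = ?N + m - p" using False Suc p by simp
        finally show ?thesis .
      qed simp
      have finP: "finite ?P" using fin by simp
      have "card (?h (x # xs) p m) \<le> card (?P \<union> ?h xs p (Suc m))"
        by (rule card_mono[OF _ sub]) (use finP fin in blast)
      also have "\<dots> \<le> card ?P + card (?h xs p (Suc m))"
        by (rule card_Un_le)
      also have "\<dots> \<le> (?N choose (?N + m - p)) + (?N choose (?N + Suc m - p))"
        by (intro add_mono P Cons.IH) (use Cons.prems in simp)
      also have "\<dots> = Suc ?N choose (Suc ?N + m - p)"
      proof -
        have "Suc ?N + m - p = Suc (?N + m - p)" "?N + Suc m - p = Suc (?N + m - p)"
          using p Suc by arith+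
        then show ?thesis by (simp only: binomial_Suc_Suc)
      qed
      finally show ?thesis by simp
    qed
  qed
qed

text \<open>Sorting the points by the number of members of the chain that omit them puts the points
  of each member before all other points, so each member becomes a prefix.\<close>

lemma chain_subset_takes:
  assumes "finite U" "finite \<I>" "\<I> \<subseteq> Pow U" "\<And>I J. I \<in> \<I> \<Longrightarrow> J \<in> \<I> \<Longrightarrow> I \<subseteq> J \<or> J \<subseteq> I"
  obtains xs where "distinct xs" "set xs = U" "\<And>I. I \<in> \<I> \<Longrightarrow> \<exists>k. I = set (take k xs)"
proof -
  obtain us where us: "set us = U" "distinct us"
    using finite_distinct_list[OF assms(1)] by blast
  define f where "f u = card {I \<in> \<I>. u \<notin> I}" for u
  define xs where "xs = sort_key f us"
  have "\<exists>k. I = set (take k xs)" if I: "I \<in> \<I>" for I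
  proof -
    have less: "f u < f v" if "u \<in> I" "v \<notin> I" for u v
      unfolding f_def
    proof (rule psubset_card_mono)
      show "finite {J \<in> \<I>. v \<notin> J}" using assms(2) by simp
      \<comment> \<open>A member \<open>J\<close> omitting \<open>u\<close> does not include
        \<open>I\<close>, hence lies inside \<open>I\<close> and omits \<open>v\<close> too. The
        inclusion is strict because \<open>I\<close> itself omits only \<open>v\<close>.\<close>
      have "v \<notin> J" if J: "J \<in> \<I>" "u \<notin> J" for J
        using assms(4)[OF I J(1)] J(2) \<open>u \<in> I\<close> \<open>v \<notin> I\<close> by blast
      then show "{J \<in> \<I>. u \<notin> J} \<subset> {J \<in> \<I>. v \<notin> J}"
        using I \<open>u \<in> I\<close> \<open>v \<notin> I\<close> by blast
    qed
    \<comment> \<open>Once a point outside \<open>I\<close> occurs, sortedness and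
      \<open>less\<close> keep all later points outside \<open>I\<close>.\<close>
    define ys zs where "ys = takeWhile (\<lambda>u. u \<in> I) xs" and "zs = dropWhile (\<lambda>u. u \<in> I) xs"
    have xs: "xs = ys @ zs" by (simp add: ys_def zs_def)
    have "sorted (map f (ys @ zs))"
      unfolding xs[symmetric] by (simp add: xs_def)
    then have srt: "sorted (map f zs)" by (simp add: sorted_append)
    have "u \<notin> I" if "u \<in> set zs" for u
    proof (cases zs)
      case (Cons z zs')
      then have "z \<notin> I" using hd_dropWhile[of "\<lambda>u. u \<in> I" xs] by (simp add: zs_def)
      moreover have "f z \<le> f u" using srt that by (auto simp: Cons)
      ultimately show ?thesis using less by force
    qed (use that in simp)
    moreover have "u \<in> I" if "u \<in> set ys" for u
      using that by (auto simp: ys_def dest: set_takeWhileD)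
    moreover have "I \<subseteq> set ys \<union> set zs"
      using I assms(3) us xs_def unfolding set_append[symmetric] xs[symmetric] by auto
    ultimately have "I = set ys" by blast
    moreover have "take (length ys) xs = ys" by (simp add: xs)
    ultimately show ?thesis by metis
  qed
  moreover have "distinct xs" "set xs = U" using us by (simp_all add: xs_def)
  ultimately show ?thesis by (rule that[rotated 2])
qed

text \<open>Members of a chain are prefixes of a common enumeration, so the prefix count applies.
  Working with chains makes ties harmless: nested events select nested index sets even if sample
  values coincide.\<close>

lemma card_chain_net_ge:
  fixes m p :: nat
  assumes "finite U" "finite \<I>" "\<I> \<subseteq> Pow U" "\<And>I J. I \<in> \<I> \<Longrightarrow> J \<in> \<I> \<Longrightarrow> I \<subseteq> J \<or> J \<subseteq> I"
  shows "card {A. A \<subseteq> U \<and> card A = p \<and> (\<exists>I\<in>\<I>. int m \<le> net A I)} \<le> card U choose (card U + m - p)"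
proof -
  obtain xs where xs: "distinct xs" "set xs = U" "\<And>I. I \<in> \<I> \<Longrightarrow> \<exists>k. I = set (take k xs)"
    using chain_subset_takes[OF assms] by metis
  have "{A. A \<subseteq> U \<and> card A = p \<and> (\<exists>I\<in>\<I>. int m \<le> net A I)}
    \<subseteq> {A. A \<subseteq> set xs \<and> card A = p \<and> (\<exists>k. int m \<le> net A (set (take k xs)))}"
    using xs by auto
  from card_mono[OF _ this] card_net_take_ge[OF xs(1), of p m] show ?thesis
    using xs distinct_card[OF xs(1)] by (simp add: rev_finite_subset[of "Pow U"] assms(1))
qed

lemma net_sum:
  assumes "finite K"
  shows "real_of_int (net A {i \<in> K. x i \<in> C}) = (\<Sum>i\<in>K. (if i \<in> A then 1 else - 1) * indicator C (x i))"
proof -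
  have "real_of_int (net A {i \<in> K. x i \<in> C}) = (\<Sum>i\<in>{i \<in> K. x i \<in> C}. if i \<in> A then 1 else - 1)"
    by (simp add: net_def if_distrib cong: if_cong)
  also have "\<dots> = (\<Sum>i\<in>K. (if i \<in> A then 1 else - 1) * indicator C (x i))"
    using assms by (intro sum.mono_neutral_cong_left) auto
  finally show ?thesis .
qed

lemma net_le_card:
  assumes "finite A" "finite I"
  shows "net A I \<le> int (card A)"
proof -
  have "net A I \<le> (\<Sum>i\<in>I. if i \<in> A then 1 else 0)"
    unfolding net_def by (intro sum_mono) auto
  also have "\<dots> = int (card (I \<inter> A))"
    using assms by (simp add: sum.If_cases)
  also have "\<dots> \<le> int (card A)" using assms by (simp add: card_mono)
  finally show ?thesis .
qed

lemma net_image: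
  assumes "inj_on f K" "A \<subseteq> K" "I \<subseteq> K"
  shows "net (f ` A) (f ` I) = net A I"
  unfolding net_def
  by (subst sum.reindex) (use assms in \<open>auto intro!: sum.cong intro: inj_on_subset simp: inj_on_image_mem_iff subset_iff\<close>)

section \<open>Exponential moments of the bridge maximum\<close>

text \<open>The squared inequality is an equality at n = 1, and its inductive step reduces to 4 n (n
  + 1) <= (2 n + 1)^2.\<close>

lemma four_power_le_central_binomial:
  assumes "n \<ge> 1"
  shows "4 ^ n \<le> 2 * sqrt (real n) * real ((2 * n) choose n)"
proof -
  have "(4 ^ n)\<^sup>2 \<le> 4 * real n * (real ((2 * n) choose n))\<^sup>2"
    using assms
  proof (induction n rule: nat_induct_at_least)
    case base
    show ?case by (simp add: numeral_2_eq_2)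
  next
    case (Suc n)
    \<comment> \<open>Two absorption identities, linked by the symmetry of row 2n + 1.\<close>
    have "Suc n * ((2 * Suc n) choose (Suc n)) = 2 * (2 * n + 1) * ((2 * n) choose n)"
    proof -
      have 1: "Suc n * ((2 * Suc n) choose (Suc n)) = (2 * n + 2) * ((2 * n + 1) choose n)"
        using Suc_times_binomial[of n "2 * n + 1"] by (simp add: numeral_2_eq_2)
      have 2: "Suc n * ((2 * n + 1) choose n) = (2 * n + 1) * ((2 * n) choose n)"
        using Suc_times_binomial[of n "2 * n"] binomial_symmetric[of n "2 * n + 1"] by simp
      show ?thesis using 1 2 by (simp add: algebra_simps)
    qed
    from arg_cong[OF this, of real] have eq: "(real n + 1) * real ((2 * Suc n) choose (Suc n)) = 2 * (2 * real n + 1) * real ((2 * n) choose n)"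
      unfolding of_nat_mult of_nat_add of_nat_Suc by (simp only: of_nat_numeral of_nat_1 add.commute)
    let ?c = "(real ((2 * n) choose n))\<^sup>2" and ?d = "(real ((2 * Suc n) choose Suc n))\<^sup>2"
    have sq: "(real n + 1)\<^sup>2 * ?d = 4 * (2 * real n + 1)\<^sup>2 * ?c"
      using arg_cong[OF eq, of "\<lambda>x. x\<^sup>2"] unfolding power_mult_distrib by simp
    have "(4 ^ Suc n)\<^sup>2 * (real n + 1) = 16 * (real n + 1) * (4 ^ n)\<^sup>2"
      by (simp add: power_mult_distrib)
    also have "\<dots> \<le> 16 * (real n + 1) * (4 * real n * ?c)"
      using Suc.IH by (intro mult_left_mono) auto
    also have "\<dots> = 16 * (4 * real n * (real n + 1)) * ?c" by simp
    also have "\<dots> \<le> 16 * (2 * real n + 1)\<^sup>2 * ?c"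
      by (intro mult_right_mono mult_left_mono) (auto simp: power2_eq_square algebra_simps)
    also have "\<dots> = 4 * (4 * (2 * real n + 1)\<^sup>2 * ?c)" by simp
    also have "\<dots> = 4 * real (Suc n) * ?d * (real n + 1)"
      unfolding sq[symmetric] by (simp add: power2_eq_square)
    finally show ?case by (simp add: mult_le_cancel_right)
  qed
  also have "\<dots> = (2 * sqrt (real n) * real ((2 * n) choose n))\<^sup>2"
    by (simp add: power_mult_distrib)
  finally show ?thesis by (rule power2_le_imp_le) simp
qed

text \<open>Hoeffding's lemma for a fair 0-1 variable, equivalently cosh (h/2) <= exp
  (h^2/8).\<close>

lemma one_plus_exp_le:
  fixes h :: real
  assumes "h \<ge> 0"
  shows "1 + exp h \<le> 2 * exp (h / 2 + h\<^sup>2 / 8)"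
proof -
  have "ln ((1 + exp h) / 2) \<le> h / 2 + h\<^sup>2 / 8"
    using Hoeffdings_lemma_aux[OF assms, of "1/2"] by (simp add: field_simps)
  then have "(1 + exp h) / 2 \<le> exp (h / 2 + h\<^sup>2 / 8)"
    by (smt (verit) exp_gt_zero exp_le_cancel_iff exp_ln half_gt_zero)
  then show ?thesis by simp
qed

text \<open>Divided by the central binomial coefficient, the sum is the exponential moment of the
  bridge maximum minus 1, written through its tails. Dominating the increments and completing the
  range turns it into a binomial generating function.\<close>

lemma sum_exp_binomial_le:
  fixes h :: real
  assumes "h \<ge> 0"
  shows "(\<Sum>m=1..n. (exp (h * real m) - exp (h * real (m - 1))) * real ((2 * n) choose (n + m)))
    \<le> h * 4 ^ n * exp (h\<^sup>2 * real n / 4)"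
proof -
  have "(\<Sum>m=1..n. (exp (h * real m) - exp (h * real (m - 1))) * real ((2 * n) choose (n + m)))
    \<le> (\<Sum>m=1..n. h * exp (h * real m) * real ((2 * n) choose (n + m)))"
  \<comment> \<open>An increment is exp (h m) (1 - exp (- h)), and 1 - exp (- h) <= h.\<close>
  proof (intro sum_mono mult_right_mono)
    fix m assume "m \<in> {1..n}"
    then have "exp (h * real (m - 1)) = exp (h * real m) * exp (- h)"
      by (simp add: exp_add[symmetric] of_nat_diff algebra_simps)
    also have "\<dots> \<ge> exp (h * real m) * (1 - h)"
      using exp_ge_add_one_self[of "- h"] by (intro mult_left_mono) auto
    finally show "exp (h * real m) - exp (h * real (m - 1)) \<le> h * exp (h * real m)"
      by (simp add: algebra_simps)
  qed simp
  \<comment> \<open>Substitute k = n + m; the missing terms of the binomial sum are then added,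
    being nonnegative.\<close>
  also have "\<dots> = (\<Sum>k\<in>(+) n ` {1..n}. h * exp (h * (real k - real n)) * real ((2 * n) choose k))"
    by (subst sum.reindex) auto
  also have "\<dots> \<le> (\<Sum>k\<le>2 * n. h * exp (h * (real k - real n)) * real ((2 * n) choose k))"
    using assms by (intro sum_mono2) auto
  also have "\<dots> = h * exp (- h * real n) * (\<Sum>k\<le>2 * n. real ((2 * n) choose k) * exp h ^ k)"
    by (simp add: sum_distrib_left exp_of_nat_mult[symmetric] exp_add[symmetric] exp_diff exp_minus field_simps)
  also have "\<dots> = h * exp (- h * real n) * (1 + exp h) ^ (2 * n)"
    using binomial_ring[of "exp h" 1 "2 * n"] by (simp add: add.commute)
  also have "\<dots> \<le> h * exp (- h * real n) * (2 * exp (h / 2 + h\<^sup>2 / 8)) ^ (2 * n)"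
    using assms by (intro mult_left_mono power_mono one_plus_exp_le) (auto intro: add_nonneg_nonneg)
  also have "\<dots> = h * exp (- h * real n) * (4 ^ n * exp (real (2 * n) * (h / 2 + h\<^sup>2 / 8)))"
    by (simp only: power_mult_distrib exp_of_nat_mult) (simp add: power_mult)
  also have "\<dots> = h * 4 ^ n * exp (h\<^sup>2 * real n / 4)"
    by (simp add: exp_add[symmetric] algebra_simps)
  finally show ?thesis .
qed

text \<open>Telescoping over the levels up to \<open>z\<close>; the constant 1 takes care of z <= 0.
  The bound is linear in the indicators of the tail events, so taking expectations turns tails into
  an exponential moment.\<close>

lemma exp_net_le:
  fixes h :: real
  assumes "h \<ge> 0" "z \<le> int n"
  shows "exp (h * real_of_int z) \<le> 1 + (\<Sum>m=1..n. (exp (h * real m) - exp (h * real (m - 1))) * of_bool (int m \<le> z))"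
proof -
  have nn: "0 \<le> exp (h * real m) - exp (h * real (m - 1))" for m
    using assms by (auto intro: mult_left_mono)
  show ?thesis
  proof (cases "z \<le> 0")
    case True
    then have "exp (h * real_of_int z) \<le> 1" using assms by (simp add: mult_nonneg_nonpos)
    moreover have "0 \<le> (\<Sum>m=1..n. (exp (h * real m) - exp (h * real (m - 1))) * of_bool (int m \<le> z))"
      by (intro sum_nonneg mult_nonneg_nonneg nn) auto
    ultimately show ?thesis by linarith
  next
    case False
    define k where "k = nat z"
    have z: "z = int k" and k: "k \<le> n" using False assms by (auto simp: k_def)
    have "exp (h * real k) = 1 + (\<Sum>m=1..k. exp (h * real m) - exp (h * real (m - 1)))"
      by (induction k) auto
    also have "(\<Sum>m=1..k. exp (h * real m) - exp (h * real (m - 1)))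
        = (\<Sum>m=1..k. (exp (h * real m) - exp (h * real (m - 1))) * of_bool (int m \<le> z))"
      by (intro sum.cong) (auto simp: z)
    also have "\<dots> \<le> (\<Sum>m=1..n. (exp (h * real m) - exp (h * real (m - 1))) * of_bool (int m \<le> z))"
      using k by (intro sum_mono2 mult_nonneg_nonneg nn) auto
    finally show ?thesis by (simp add: z)
  qed
qed

section \<open>Independent samples and chains of sets\<close>

locale iid_sequence = prob_space M
  for M :: "'a measure" +
  fixes N :: "'b measure" and D :: "'b measure" and X :: "nat \<Rightarrow> 'a \<Rightarrow> 'b"
  assumes indep: "indep_vars (\<lambda>_. N) X {1..}"
    and ident: "\<And>i. i \<ge> 1 \<Longrightarrow> distr M N (X i) = D"
begin

lemma integrable_indicator_events [simp]:
  "A \<in> events \<Longrightarrow> integrable M (indicator A :: 'a \<Rightarrow> real)"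
  by (intro integrable_real_indicator) (auto simp: less_top[symmetric])

lemma measurable_X: "i \<ge> 1 \<Longrightarrow> X i \<in> measurable M N"
  using indep by (auto simp: indep_vars_def)

lemma sets_D [simp]: "sets D = sets N" and space_D [simp]: "space D = space N"
  using ident[of 1] by auto

lemma prob_space_D: "prob_space D"
  using prob_space_distr[OF measurable_X[of 1]] ident[of 1] by simp

lemma prob_X: "i \<ge> 1 \<Longrightarrow> C \<in> sets N \<Longrightarrow> prob (X i -` C \<inter> space M) = measure D C"
  using measure_distr[OF measurable_X] ident by metis

section \<open>Exchangeability and the two-sample tail\<close>

lemma joint_distr:
  assumes "K \<subseteq> {1..}" "K \<noteq> {}"
  shows "distr M (Pi\<^sub>M K (\<lambda>_. N)) (\<lambda>\<omega>. \<lambda>i\<in>K. X i \<omega>) = Pi\<^sub>M K (\<lambda>_. D)"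
proof -
  have "indep_vars (\<lambda>_. N) X K" using indep assms(1) by (rule indep_vars_subset)
  then have "distr M (Pi\<^sub>M K (\<lambda>_. N)) (\<lambda>\<omega>. \<lambda>i\<in>K. X i \<omega>) = (\<Pi>\<^sub>M i\<in>K. distr M N (X i))"
    using assms measurable_X by (subst (asm) indep_vars_iff_distr_eq_PiM') auto
  also have "\<dots> = Pi\<^sub>M K (\<lambda>_. D)"
    using assms ident by (intro PiM_cong) auto
  finally show ?thesis .
qed

text \<open>The joint law is a power of \<open>D\<close>, which a permutation of the coordinates
  leaves invariant.\<close>

lemma prob_restrict_permute:
  assumes K: "K \<subseteq> {1..}" "K \<noteq> {}" and \<pi>: "bij_betw \<pi> K K"
    and B: "B \<in> sets (Pi\<^sub>M K (\<lambda>_. N))"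
  shows "prob {\<omega> \<in> space M. (\<lambda>i\<in>K. X (\<pi> i) \<omega>) \<in> B} = prob {\<omega> \<in> space M. (\<lambda>i\<in>K. X i \<omega>) \<in> B}"
proof -
  let ?PN = "Pi\<^sub>M K (\<lambda>_. N)" and ?PD = "Pi\<^sub>M K (\<lambda>_. D)"
  have sets: "sets ?PN = sets ?PD" by (intro sets_PiM_cong) auto
  have \<pi>K: "\<pi> i \<in> K" if "i \<in> K" for i using \<pi> that by (auto simp: bij_betw_def)
  have X: "(\<lambda>\<omega>. \<lambda>i\<in>K. X i \<omega>) \<in> measurable M ?PN"
    using K measurable_X by (intro measurable_restrict) auto
  have p: "(\<lambda>x. \<lambda>i\<in>K. x (\<pi> i)) \<in> measurable ?PN ?PN"
    using \<pi>K by (intro measurable_restrict measurable_component_singleton) auto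
  have "distr M ?PN (\<lambda>\<omega>. \<lambda>i\<in>K. X (\<pi> i) \<omega>) = distr (distr M ?PN (\<lambda>\<omega>. \<lambda>i\<in>K. X i \<omega>)) ?PN (\<lambda>x. \<lambda>i\<in>K. x (\<pi> i))"
    by (subst distr_distr[OF p X]) (auto simp: comp_def \<pi>K intro!: distr_cong)
  also have "\<dots> = distr ?PD ?PD (\<lambda>x. \<lambda>i\<in>K. x (\<pi> i))"
    unfolding joint_distr[OF K] by (intro distr_cong sets) auto
  also have "\<dots> = ?PD"
    using prob_space_D \<pi> by (intro distr_PiM_reindex) (auto simp: bij_betw_def)
  also have "\<dots> = distr M ?PN (\<lambda>\<omega>. \<lambda>i\<in>K. X i \<omega>)"
    using joint_distr[OF K] by simp
  finally have eq: "distr M ?PN (\<lambda>\<omega>. \<lambda>i\<in>K. X (\<pi> i) \<omega>) = distr M ?PN (\<lambda>\<omega>. \<lambda>i\<in>K. X i \<omega>)" .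
  have X': "(\<lambda>\<omega>. \<lambda>i\<in>K. X (\<pi> i) \<omega>) \<in> measurable M ?PN"
    using K measurable_X \<pi>K by (intro measurable_restrict) fastforce
  show ?thesis
    using arg_cong[OF eq, of "\<lambda>\<mu>. measure \<mu> B"] B
    by (simp add: measure_distr X X' vimage_def Int_def conj_commute)
qed

text \<open>By exchangeability \<open>{1..n}\<close> may be replaced by any n-subset of the 2n
  labels without changing the probability. Averaging over all of them leaves, at a fixed outcome,
  only the labels random, and the ballot count applies.\<close>

lemma prob_two_sample_ge:
  fixes \<C> :: "'b set set" and n m :: nat
  assumes fin: "finite \<C>" and meas: "\<C> \<subseteq> sets N"
    and chain: "\<And>C C'. C \<in> \<C> \<Longrightarrow> C' \<in> \<C> \<Longrightarrow> C \<subseteq> C' \<or> C' \<subseteq> C"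
    and n: "n \<ge> 1"
  shows "prob {\<omega> \<in> space M. \<exists>C\<in>\<C>. int m \<le> net {1..n} {i \<in> {1..2*n}. X i \<omega> \<in> C}}
    \<le> real ((2 * n) choose (n + m)) / real ((2 * n) choose n)"
proof -
  let ?K = "{1..2 * n}"
  define B where "B A = {x \<in> space (Pi\<^sub>M ?K (\<lambda>_. N)). \<exists>C\<in>\<C>. int m \<le> net A {i \<in> ?K. x i \<in> C}}" for A
  define H where "H A = {\<omega> \<in> space M. \<exists>C\<in>\<C>. int m \<le> net A {i \<in> ?K. X i \<omega> \<in> C}}" for A
  define \<A> where "\<A> = {A. A \<subseteq> ?K \<and> card A = n}"
  \<comment> \<open>Signed indicator sums over the reals are a form in which measurability is
    immediate.\<close>
  have net_iff: "int m \<le> net A {i \<in> ?K. x i \<in> C} \<longleftrightarrow>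
      real m \<le> (\<Sum>i\<in>?K. (if i \<in> A then 1 else - 1) * indicator C (x i))" for A x C
    unfolding net_sum[OF finite_atLeastAtMost, symmetric] by linarith
  have B: "B A \<in> sets (Pi\<^sub>M ?K (\<lambda>_. N))" for A
  proof -
    have [measurable]: "C \<in> sets N" if "C \<in> \<C>" for C using meas that by auto
    show ?thesis unfolding B_def net_iff using fin by measurable
  qed
  have space: "(\<lambda>i\<in>?K. X (\<pi> i) \<omega>) \<in> space (Pi\<^sub>M ?K (\<lambda>_. N))"
    if "\<omega> \<in> space M" "\<And>i. i \<in> ?K \<Longrightarrow> \<pi> i \<in> ?K" for \<omega> \<pi>
    using that measurable_space[OF measurable_X] by (fastforce simp: space_PiM)
  have H_B: "H A = {\<omega> \<in> space M. (\<lambda>i\<in>?K. X i \<omega>) \<in> B A}" for A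
    unfolding H_def B_def using space[of _ "\<lambda>i. i"] by (auto cong: conj_cong)
  have H_meas [measurable]: "H A \<in> events" for A
  proof -
    have "(\<lambda>\<omega>. \<lambda>i\<in>?K. X i \<omega>) \<in> measurable M (Pi\<^sub>M ?K (\<lambda>_. N))"
      using measurable_X by (intro measurable_restrict) auto
    from measurable_sets[OF this B[of A]] show ?thesis
      unfolding H_B by (simp add: vimage_def Int_def conj_commute)
  qed
  have H_eq: "prob (H A) = prob (H {1..n})" if A: "A \<in> \<A>" for A
  proof -
    have fA: "finite A" and AK: "A \<subseteq> ?K" "card A = n" using A finite_subset by (auto simp: \<A>_def)
    obtain f where f: "bij_betw f {1..n} A"
      using fA AK by (metis card_atLeastAtMost diff_Suc_1 finite_atLeastAtMost finite_same_card_bij)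
    have "card ({n+1..2*n}) = card (?K - A)"
      using AK by (simp add: card_Diff_subset fA)
    then obtain g where g: "bij_betw g {n+1..2*n} (?K - A)"
      by (metis finite_Diff finite_atLeastAtMost finite_same_card_bij)
    \<comment> \<open>A permutation of the 2n labels that carries the first block onto
      \<open>A\<close>, glued from two bijections.\<close>
    define \<pi> where "\<pi> i = (if i \<in> {1..n} then f i else g i)" for i
    have "bij_betw \<pi> ({1..n} \<union> {n+1..2*n}) (A \<union> (?K - A))"
      unfolding \<pi>_def by (rule bij_betw_disjoint_Un[OF f g]) auto
    moreover have "{1..n} \<union> {n+1..2*n} = ?K" "A \<union> (?K - A) = ?K" using AK by auto
    ultimately have \<pi>: "bij_betw \<pi> ?K ?K" by simp
    have \<pi>A: "\<pi> ` {1..n} = A" using f by (auto simp: \<pi>_def bij_betw_def)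
    have \<pi>K: "\<pi> i \<in> ?K" if "i \<in> ?K" for i using bij_betwE[OF \<pi>] that by blast
    have net_eq: "net {1..n} {i \<in> ?K. X (\<pi> i) \<omega> \<in> C} = net A {i \<in> ?K. X i \<omega> \<in> C}" for \<omega> C
    proof -
      have "net (\<pi> ` {1..n}) (\<pi> ` {i \<in> ?K. X (\<pi> i) \<omega> \<in> C}) = net {1..n} {i \<in> ?K. X (\<pi> i) \<omega> \<in> C}"
        using \<pi> by (intro net_image[of _ ?K]) (auto simp: bij_betw_def)
      moreover have "\<pi> ` {i \<in> ?K. X (\<pi> i) \<omega> \<in> C} = {i \<in> ?K. X i \<omega> \<in> C}"
      proof -
        have "\<pi> ` {i \<in> ?K. X (\<pi> i) \<omega> \<in> C} = {i \<in> \<pi> ` ?K. X i \<omega> \<in> C}" by blast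
        also have "\<pi> ` ?K = ?K" using \<pi> by (simp add: bij_betw_def)
        finally show ?thesis .
      qed
      ultimately show ?thesis using \<pi>A by simp
    qed
    have "prob (H {1..n}) = prob {\<omega> \<in> space M. (\<lambda>i\<in>?K. X (\<pi> i) \<omega>) \<in> B {1..n}}"
      unfolding H_B using n by (intro prob_restrict_permute[symmetric] \<pi> B) auto
    also have "{\<omega> \<in> space M. (\<lambda>i\<in>?K. X (\<pi> i) \<omega>) \<in> B {1..n}} = H A"
      unfolding H_def B_def net_eq[symmetric]
      using space[of _ \<pi>] \<pi>K by (auto cong: conj_cong)
    finally show ?thesis ..
  qed
  have fin\<A>: "finite \<A>" by (rule finite_subset[of _ "Pow ?K"]) (auto simp: \<A>_def)
  have card\<A>: "card \<A> = (2 * n) choose n"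
    unfolding \<A>_def by (subst n_subsets) auto
  have pointwise: "(\<Sum>A\<in>\<A>. indicator (H A) \<omega>) \<le> real ((2 * n) choose (n + m))" if \<omega>: "\<omega> \<in> space M" for \<omega>
  proof -
    let ?\<I> = "(\<lambda>C. {i \<in> ?K. X i \<omega> \<in> C}) ` \<C>"
    have "(\<Sum>A\<in>\<A>. indicator (H A) \<omega>) = real (card {A \<in> \<A>. \<omega> \<in> H A})"
      using fin\<A> by (simp add: indicator_def sum.If_cases Int_def)
    also have "{A \<in> \<A>. \<omega> \<in> H A} = {A. A \<subseteq> ?K \<and> card A = n \<and> (\<exists>I\<in>?\<I>. int m \<le> net A I)}"
      using \<omega> by (auto simp: \<A>_def H_def)
    also have "card \<dots> \<le> card ?K choose (card ?K + m - n)"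
    proof (rule card_chain_net_ge)
      fix I J assume "I \<in> ?\<I>" "J \<in> ?\<I>"
      then obtain C C' where C: "C \<in> \<C>" "C' \<in> \<C>"
        and IJ: "I = {i \<in> ?K. X i \<omega> \<in> C}" "J = {i \<in> ?K. X i \<omega> \<in> C'}" by blast
      from chain[OF C] show "I \<subseteq> J \<or> J \<subseteq> I" unfolding IJ by blast
    qed (use fin in auto)
    finally show ?thesis by simp
  qed
  \<comment> \<open>Double counting: the sum of the probabilities is the expected number of
    labellings \<open>A\<close> for which the event occurs.\<close>
  have "real ((2 * n) choose n) * prob (H {1..n}) = (\<Sum>A\<in>\<A>. prob (H A))"
    using H_eq card\<A> by simp
  also have "\<dots> = expectation (\<lambda>\<omega>. \<Sum>A\<in>\<A>. indicator (H A) \<omega>)"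
    by (subst Bochner_Integration.integral_sum) auto
  also have "\<dots> \<le> expectation (\<lambda>\<omega>. real ((2 * n) choose (n + m)))"
    by (intro integral_mono pointwise) auto
  also have "\<dots> = real ((2 * n) choose (n + m))" by (simp add: prob_space)
  finally show ?thesis
    unfolding H_def by (simp add: field_simps)
qed

section \<open>Maximal inequality by first exceedance and a ghost sample\<close>

definition dev :: "nat \<Rightarrow> 'b set \<Rightarrow> 'a \<Rightarrow> real" where
  "dev t C \<omega> = (\<Sum>i=1..t. indicator C (X i \<omega>) - measure D C)"

lemma measurable_indicator_X [measurable]:
  "i \<ge> 1 \<Longrightarrow> C \<in> sets N \<Longrightarrow> (\<lambda>\<omega>. indicator C (X i \<omega>) :: real) \<in> borel_measurable M"
  by (rule measurable_compose[OF measurable_X borel_measurable_indicator])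

lemma measurable_dev [measurable]: "C \<in> sets N \<Longrightarrow> dev t C \<in> borel_measurable M"
  unfolding dev_def[abs_def]
  by (intro borel_measurable_sum borel_measurable_diff borel_measurable_const measurable_indicator_X) auto

text \<open>Independence of \<open>X i\<close> from the first \<open>t\<close> observations gives
  the factor \<open>measure D C\<close>, which the centring cancels. This is the martingale property
  needed for the remainder after a first exceedance.\<close>

lemma expectation_past_times_centred:
  assumes B: "B \<in> sets (Pi\<^sub>M {1..t} (\<lambda>_. N))" and i: "i > t" and C: "C \<in> sets N"
  defines "E \<equiv> {\<omega> \<in> space M. (\<lambda>j\<in>{1..t}. X j \<omega>) \<in> B}"
  shows "expectation (\<lambda>\<omega>. indicator E \<omega> * (indicator C (X i \<omega>) - measure D C)) = 0"
proof -
  let ?past = "\<lambda>\<omega>. \<lambda>j\<in>{1..t}. X j \<omega>" and ?pres = "\<lambda>\<omega>. \<lambda>j\<in>{i}. X j \<omega>"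
  let ?F = "X i -` C \<inter> space M" and ?C = "Pi\<^sub>E {i} (\<lambda>_. C)"
  have past: "?past \<in> measurable M (Pi\<^sub>M {1..t} (\<lambda>_. N))"
    using measurable_X by (intro measurable_restrict) auto
  have E: "E = ?past -` B \<inter> space M" by (auto simp: E_def)
  have E_meas [measurable]: "E \<in> events" unfolding E using measurable_sets[OF past B] .
  have F_meas [measurable]: "?F \<in> events" using measurable_sets[OF measurable_X C] i by simp
  \<comment> \<open>\<open>X i\<close> enters as a block with one coordinate, since independence is
    available between disjoint blocks of the family.\<close>
  have "indep_var (Pi\<^sub>M {1..t} (\<lambda>_. N)) ?past (Pi\<^sub>M {i} (\<lambda>_. N)) ?pres"
    using i by (intro indep_var_restrict[OF indep]) auto
  from indep_varD[OF this B, of ?C]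
  have "prob ((\<lambda>\<omega>. (?past \<omega>, ?pres \<omega>)) -` (B \<times> ?C) \<inter> space M) = prob E * prob (?pres -` ?C \<inter> space M)"
    using C unfolding E by simp
  also have "(\<lambda>\<omega>. (?past \<omega>, ?pres \<omega>)) -` (B \<times> ?C) \<inter> space M = E \<inter> ?F"
    unfolding E_def by (auto simp: PiE_iff)
  also have "?pres -` ?C \<inter> space M = ?F" by (auto simp: PiE_iff)
  also have "prob ?F = measure D C" using i C by (intro prob_X) auto
  finally have indep_EF: "prob (E \<inter> ?F) = prob E * measure D C" .
  have "expectation (\<lambda>\<omega>. indicator E \<omega> * (indicator C (X i \<omega>) - measure D C))
      = expectation (\<lambda>\<omega>. indicator (E \<inter> ?F) \<omega> - measure D C * indicator E \<omega>)"
    by (intro Bochner_Integration.integral_cong) (auto simp: indicator_def)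
  also have "\<dots> = prob (E \<inter> ?F) - measure D C * prob E"
    by (subst Bochner_Integration.integral_diff) auto
  finally show ?thesis by (simp add: indep_EF)
qed

text \<open>An exponential Markov inequality over times and sets at once. Each first exceedance is
  carried forward to the full two-sample count, and a single majorant \<open>G\<close> serves all
  these disjoint events; its mean follows from the two-sample tail.\<close>

lemma prob_sup_dev_ge_finite:
  fixes \<C> :: "'b set set" and n :: nat and a h :: real
  assumes fin: "finite \<C>" and meas: "\<C> \<subseteq> sets N"
    and chain: "\<And>C C'. C \<in> \<C> \<Longrightarrow> C' \<in> \<C> \<Longrightarrow> C \<subseteq> C' \<or> C' \<subseteq> C"
    and n: "n \<ge> 1" and h: "h \<ge> 0"
  shows "prob {\<omega> \<in> space M. \<exists>t\<in>{1..n}. \<exists>C\<in>\<C>. a \<le> dev t C \<omega>}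
    \<le> exp (- h * a) * (1 + 2 * h * sqrt (real n) * exp (h\<^sup>2 * real n / 4))"
proof -
  let ?K = "{1..2 * n}"
  define V where "V = {\<omega> \<in> space M. \<exists>t\<in>{1..n}. \<exists>C\<in>\<C>. a \<le> dev t C \<omega>}"
  have Cm [measurable]: "C \<in> sets N" if "C \<in> \<C>" for C using meas that by auto
  \<comment> \<open>The enumeration decides which set counts as first when several exceed at the
    same time.\<close>
  obtain f :: "nat \<Rightarrow> 'b set" where f: "bij_betw f {0..<card \<C>} \<C>"
    using ex_bij_betw_nat_finite[OF fin] by blast
  define c where "c = card \<C>"
  have f_in: "f j \<in> \<C>" if "j < c" for j using f that by (auto simp: bij_betw_def c_def)
  have f_ex: "\<exists>j<c. C = f j" if "C \<in> \<C>" for C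
    using f that unfolding bij_betw_def c_def by (metis atLeastLessThan_iff imageE)
  \<comment> \<open>the lexicographically first exceedance; the event depends on $X_1, \dots, X_t$ only\<close>
  define E where "E = (\<lambda>(t, j). {\<omega> \<in> space M. a \<le> dev t (f j) \<omega> \<and>
    (\<forall>s\<in>{1..<t}. \<forall>C\<in>\<C>. \<not> a \<le> dev s C \<omega>) \<and> (\<forall>j'\<in>{..<j}. \<not> a \<le> dev t (f j') \<omega>)})"
  define Q where "Q = {1..n} \<times> {..<c}"
  have finQ: "finite Q" by (simp add: Q_def)
  \<comment> \<open>Of two different pairs, the lexicographically later one forbids the exceedance
    that the earlier one demands.\<close>
  have disj: "disjoint_family_on E Q"
  proof (unfold disjoint_family_on_def, intro ballI impI)
    fix p q assume p: "p \<in> Q" and q: "q \<in> Q" and "p \<noteq> q"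
    obtain t j s i where pq: "p = (t, j)" "q = (s, i)" by (metis surj_pair)
    consider "t < s" | "s < t" | "t = s" "j < i" | "t = s" "i < j"
      using \<open>p \<noteq> q\<close> pq by fastforce
    then show "E p \<inter> E q = {}"
      using p q f_in unfolding pq E_def Q_def by cases (fastforce)+
  qed
  have V_E: "V = (\<Union>p\<in>Q. E p)"
  proof (intro equalityI subsetI)
    fix \<omega> assume \<omega>: "\<omega> \<in> V"
    define t where "t = (LEAST t. t \<in> {1..n} \<and> (\<exists>C\<in>\<C>. a \<le> dev t C \<omega>))"
    have t: "t \<in> {1..n} \<and> (\<exists>C\<in>\<C>. a \<le> dev t C \<omega>)"
      unfolding t_def by (rule LeastI_ex) (use \<omega> in \<open>auto simp: V_def\<close>)
    have t_least: "\<forall>s\<in>{1..<t}. \<forall>C\<in>\<C>. \<not> a \<le> dev s C \<omega>"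
    proof (intro ballI notI)
      fix s C assume s: "s \<in> {1..<t}" "C \<in> \<C>" "a \<le> dev s C \<omega>"
      then have "s \<in> {1..n} \<and> (\<exists>C\<in>\<C>. a \<le> dev s C \<omega>)" using t by auto
      then have "t \<le> s" unfolding t_def by (rule Least_le)
      then show False using s by simp
    qed
    define j where "j = (LEAST j. j < c \<and> a \<le> dev t (f j) \<omega>)"
    have j: "j < c \<and> a \<le> dev t (f j) \<omega>"
      unfolding j_def by (rule LeastI_ex) (use t f_ex in blast)
    have j_least: "\<forall>j'\<in>{..<j}. \<not> a \<le> dev t (f j') \<omega>"
      using not_less_Least[of _ "\<lambda>j. j < c \<and> a \<le> dev t (f j) \<omega>"] j unfolding j_def[symmetric] by fastforce
    have "\<omega> \<in> E (t, j)" "(t, j) \<in> Q"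
      using \<omega> t t_least j j_least by (auto simp: E_def Q_def V_def)
    then show "\<omega> \<in> (\<Union>p\<in>Q. E p)" by blast
  next
    fix \<omega> assume "\<omega> \<in> (\<Union>p\<in>Q. E p)"
    then show "\<omega> \<in> V" using f_in by (auto simp: E_def Q_def V_def)
  qed
  have E_past: "\<exists>B \<in> sets (Pi\<^sub>M {1..t} (\<lambda>_. N)). E (t, j) = {\<omega> \<in> space M. (\<lambda>i\<in>{1..t}. X i \<omega>) \<in> B}"
    if p: "(t, j) \<in> Q" for t j
  proof -
    \<comment> \<open>\<open>d\<close> is \<open>dev\<close> read off the coordinates, which
      exhibits the event as the preimage of a set \<open>B\<close> of paths up to time
      \<open>t\<close>.\<close>
    define d where "d s C x = (\<Sum>i=1..s. indicator C (x i) - measure D C)" for s C and x :: "nat \<Rightarrow> 'b"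
    define B where "B = {x \<in> space (Pi\<^sub>M {1..t} (\<lambda>_. N)). a \<le> d t (f j) x \<and>
      (\<forall>s\<in>{1..<t}. \<forall>C\<in>\<C>. \<not> a \<le> d s C x) \<and> (\<forall>j'\<in>{..<j}. \<not> a \<le> d t (f j') x)}"
    have d_meas: "d s C \<in> borel_measurable (Pi\<^sub>M {1..t} (\<lambda>_. N))" if "s \<le> t" "C \<in> sets N" for s C
      unfolding d_def using that
      by (intro borel_measurable_sum borel_measurable_diff borel_measurable_const
          measurable_compose[OF measurable_component_singleton borel_measurable_indicator]) auto
    have [measurable]: "d s C \<in> borel_measurable (Pi\<^sub>M {1..t} (\<lambda>_. N))" if "s \<in> {1..<t}" "C \<in> \<C>" for s C
      using that by (intro d_meas) auto
    have jc: "j < c" using p by (auto simp: Q_def)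
    have [measurable]: "d t (f j) \<in> borel_measurable (Pi\<^sub>M {1..t} (\<lambda>_. N))"
      by (intro d_meas Cm f_in jc) simp
    have [measurable]: "d t (f i) \<in> borel_measurable (Pi\<^sub>M {1..t} (\<lambda>_. N))" if "i \<in> {..<j}" for i
      using that jc by (intro d_meas Cm f_in) auto
    have "B \<in> sets (Pi\<^sub>M {1..t} (\<lambda>_. N))"
      unfolding B_def using fin by measurable
    moreover have d_dev: "d s C (\<lambda>i\<in>{1..t}. X i \<omega>) = dev s C \<omega>" if "s \<le> t" for s C \<omega>
      unfolding d_def dev_def using that by (intro sum.cong) auto
    have "(\<lambda>i\<in>{1..t}. X i \<omega>) \<in> space (Pi\<^sub>M {1..t} (\<lambda>_. N))" if "\<omega> \<in> space M" for \<omega>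
      using that measurable_space[OF measurable_X] by (auto simp: space_PiM)
    then have "E (t, j) = {\<omega> \<in> space M. (\<lambda>i\<in>{1..t}. X i \<omega>) \<in> B}"
      unfolding E_def B_def by (auto simp: d_dev[unfolded One_nat_def])
    ultimately show ?thesis by blast
  qed
  have E_meas [measurable]: "E p \<in> events" if "p \<in> Q" for p
    unfolding E_def using that f_in fin by (cases p) (auto simp: Q_def intro!: sets.sets_Collect)
  define H where "H m = {\<omega> \<in> space M. \<exists>C\<in>\<C>. int m \<le> net {1..n} {i \<in> ?K. X i \<omega> \<in> C}}" for m :: nat
  have H_meas [measurable]: "H m \<in> events" for m
  proof -
    have net_iff: "int m \<le> net A {i \<in> ?K. X i \<omega> \<in> C} \<longleftrightarrow>
      real m \<le> (\<Sum>i\<in>?K. (if i \<in> A then 1 else - 1) * indicator C (X i \<omega>))" for A C \<omega>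
      unfolding net_sum[OF finite_atLeastAtMost, symmetric] by linarith
    show ?thesis unfolding H_def net_iff using fin by measurable
  qed
  define w where "w m = exp (h * real m) - exp (h * real (m - 1))" for m :: nat
  have w: "0 \<le> w m" for m unfolding w_def using h by (auto intro: mult_left_mono)
  \<comment> \<open>\<open>H m\<close> says that some set of the chain reaches level m, so
    \<open>G\<close> dominates the exponential of the count for all sets simultaneously.\<close>
  define G where "G \<omega> = 1 + (\<Sum>m=1..n. w m * indicator (H m) \<omega>)" for \<omega>
  have wH_int: "integrable M (\<lambda>\<omega>. w m * indicator (H m) \<omega>)" for m
    by (intro integrable_mult_right integrable_indicator_events H_meas)
  have G_int [simp]: "integrable M G"
    unfolding G_def by (intro Bochner_Integration.integrable_add Bochner_Integration.integrable_sum wH_int) simp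
  have G_ge: "exp (h * net {1..n} {i \<in> ?K. X i \<omega> \<in> C}) \<le> G \<omega>"
    if "\<omega> \<in> space M" "C \<in> \<C>" for \<omega> C
  proof -
    let ?z = "net {1..n} {i \<in> ?K. X i \<omega> \<in> C}"
    \<comment> \<open>Only n steps go up, so levels beyond n do not occur.\<close>
    have "?z \<le> int n" using net_le_card[of "{1..n}" "{i \<in> ?K. X i \<omega> \<in> C}"] by simp
    from exp_net_le[OF h this]
    have "exp (h * ?z) \<le> 1 + (\<Sum>m=1..n. w m * of_bool (int m \<le> ?z))" unfolding w_def .
    also have "\<dots> \<le> G \<omega>"
      unfolding G_def using that
      by (intro add_mono sum_mono mult_left_mono w) (auto simp: H_def indicator_def)
    finally show ?thesis .
  qed
  \<comment> \<open>the net count is the deviation at time $t$ plus a centred remainder $R$ independent of the past,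
    so $e^{hR} \ge 1 + hR$ suffices in place of Jensen's inequality\<close>
  have EG: "exp (h * a) * prob (E p) \<le> expectation (\<lambda>\<omega>. indicator (E p) \<omega> * G \<omega>)" if p: "p \<in> Q" for p
  proof -
    obtain t j where tj: "p = (t, j)" by (metis surj_pair)
    have t: "t \<in> {1..n}" and j: "j < c" using p by (auto simp: tj Q_def)
    define C where "C = f j"
    have C: "C \<in> \<C>" "C \<in> sets N" using f_in[OF j] by (auto simp: C_def)
    obtain B where B: "B \<in> sets (Pi\<^sub>M {1..t} (\<lambda>_. N))" and
      EB: "E p = {\<omega> \<in> space M. (\<lambda>i\<in>{1..t}. X i \<omega>) \<in> B}"
      using E_past p unfolding tj by blast
    define \<sigma> where "\<sigma> i = (if i \<le> n then 1 else - 1 :: real)" for i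
    define R where "R \<omega> = (\<Sum>i=t+1..2*n. \<sigma> i * (indicator C (X i \<omega>) - measure D C))" for \<omega>
    have net_R: "real_of_int (net {1..n} {i \<in> ?K. X i \<omega> \<in> C}) = dev t C \<omega> + R \<omega>" for \<omega>
    proof -
      \<comment> \<open>There are as many plus as minus signs, so centring every indicator leaves
        the signed count unchanged.\<close>
      have "(\<Sum>i\<in>?K. \<sigma> i) = 0"
      proof -
        have "?K = {1..n} \<union> {n+1..2*n}" by auto
        then have "(\<Sum>i\<in>?K. \<sigma> i) = (\<Sum>i\<in>{1..n}. \<sigma> i) + (\<Sum>i\<in>{n+1..2*n}. \<sigma> i)"
          by (simp add: sum.union_disjoint)
        also have "(\<Sum>i\<in>{1..n}. \<sigma> i) = (\<Sum>i\<in>{1..n}. 1)" by (intro sum.cong) (auto simp: \<sigma>_def)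
        also have "(\<Sum>i\<in>{n+1..2*n}. \<sigma> i) = (\<Sum>i\<in>{n+1..2*n}. - 1)" by (intro sum.cong) (auto simp: \<sigma>_def)
        finally show ?thesis by simp
      qed
      then have "(\<Sum>i\<in>?K. \<sigma> i * measure D C) = 0" by (simp add: sum_distrib_right[symmetric])
      moreover have "real_of_int (net {1..n} {i \<in> ?K. X i \<omega> \<in> C}) = (\<Sum>i\<in>?K. \<sigma> i * indicator C (X i \<omega>))"
        unfolding net_sum[OF finite_atLeastAtMost] by (intro sum.cong) (auto simp: \<sigma>_def)
      ultimately have "real_of_int (net {1..n} {i \<in> ?K. X i \<omega> \<in> C})
          = (\<Sum>i\<in>?K. \<sigma> i * (indicator C (X i \<omega>) - measure D C))"
        by (simp add: right_diff_distrib sum_subtractf)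
      also have "\<dots> = (\<Sum>i\<in>{1..t} \<union> {t+1..2*n}. \<sigma> i * (indicator C (X i \<omega>) - measure D C))"
        using t by (intro sum.cong) auto
      also have "(\<Sum>i\<in>{1..t} \<union> {t+1..2*n}. \<sigma> i * (indicator C (X i \<omega>) - measure D C))
          = (\<Sum>i=1..t. \<sigma> i * (indicator C (X i \<omega>) - measure D C)) + R \<omega>"
        unfolding R_def by (rule sum.union_disjoint) auto
      \<comment> \<open>Since t <= n, all signs up to time t are +1 and the past contributes exactly
        the deviation.\<close>
      also have "(\<Sum>i=1..t. \<sigma> i * (indicator C (X i \<omega>) - measure D C)) = dev t C \<omega>"
        unfolding dev_def using t by (intro sum.cong) (auto simp: \<sigma>_def)
      finally show ?thesis .
    qed
    have E_p [measurable]: "E p \<in> events" using E_meas p .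
    have term_int: "integrable M (\<lambda>\<omega>. indicator (E p) \<omega> * (\<sigma> i * (indicator C (X i \<omega>) - measure D C)))"
      if "i \<ge> 1" for i
    proof (rule integrable_const_bound[of _ "1 + \<bar>measure D C\<bar>"])
      show "AE \<omega> in M. norm (indicator (E p) \<omega> * (\<sigma> i * (indicator C (X i \<omega>) - measure D C))) \<le> 1 + \<bar>measure D C\<bar>"
        by (intro AE_I2) (auto simp: indicator_def \<sigma>_def abs_mult abs_le_iff intro: add_nonneg_nonneg)
    qed (use that C in measurable)
    have ER_sum: "indicator (E p) \<omega> * R \<omega>
        = (\<Sum>i=t+1..2*n. indicator (E p) \<omega> * (\<sigma> i * (indicator C (X i \<omega>) - measure D C)))" for \<omega>
      unfolding R_def by (rule sum_distrib_left)
    have ER_int: "integrable M (\<lambda>\<omega>. indicator (E p) \<omega> * R \<omega>)"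
      unfolding ER_sum by (intro Bochner_Integration.integrable_sum term_int) auto
    have ER: "expectation (\<lambda>\<omega>. indicator (E p) \<omega> * R \<omega>) = 0"
    proof -
      have "expectation (\<lambda>\<omega>. indicator (E p) \<omega> * (\<sigma> i * (indicator C (X i \<omega>) - measure D C))) = 0"
        if "i > t" for i
      proof -
        have "expectation (\<lambda>\<omega>. indicator (E p) \<omega> * (\<sigma> i * (indicator C (X i \<omega>) - measure D C)))
          = expectation (\<lambda>\<omega>. \<sigma> i * (indicator (E p) \<omega> * (indicator C (X i \<omega>) - measure D C)))"
          by (simp only: mult.left_commute)
        also have "\<dots> = 0"
          using expectation_past_times_centred[OF B that C(2)] unfolding EB by simp
        finally show ?thesis .
      qed
      then show ?thesis
        unfolding ER_sum by (subst Bochner_Integration.integral_sum) (auto intro!: term_int)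
    qed
    have "exp (h * a) * prob (E p)
        = expectation (\<lambda>\<omega>. exp (h * a) * (indicator (E p) \<omega> + h * (indicator (E p) \<omega> * R \<omega>)))"
      using ER ER_int by simp
    also have "\<dots> \<le> expectation (\<lambda>\<omega>. indicator (E p) \<omega> * G \<omega>)"
    proof (rule integral_mono)
      show "integrable M (\<lambda>\<omega>. exp (h * a) * (indicator (E p) \<omega> + h * (indicator (E p) \<omega> * R \<omega>)))"
        using ER_int by (intro integrable_mult_right Bochner_Integration.integrable_add) auto
      show "integrable M (\<lambda>\<omega>. indicator (E p) \<omega> * G \<omega>)"
        using integrable_mult_indicator[OF E_p G_int] by simp
      fix \<omega> assume \<omega>: "\<omega> \<in> space M"
      show "exp (h * a) * (indicator (E p) \<omega> + h * (indicator (E p) \<omega> * R \<omega>)) \<le> indicator (E p) \<omega> * G \<omega>"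
      proof (cases "\<omega> \<in> E p")
        case True
        have "a \<le> dev t C \<omega>" using True by (auto simp: tj E_def C_def)
        then have "exp (h * a) * exp (h * R \<omega>) \<le> exp (h * net {1..n} {i \<in> ?K. X i \<omega> \<in> C})"
          unfolding net_R using h by (simp add: exp_add[symmetric] distrib_left mult_left_mono)
        also have "\<dots> \<le> G \<omega>" by (rule G_ge[OF \<omega> C(1)])
        finally have "exp (h * a) * exp (h * R \<omega>) \<le> G \<omega>" .
        moreover have "exp (h * a) * (1 + h * R \<omega>) \<le> exp (h * a) * exp (h * R \<omega>)"
          by (intro mult_left_mono exp_ge_add_one_self) simp
        ultimately have "exp (h * a) * (1 + h * R \<omega>) \<le> G \<omega>" by linarith
        then show ?thesis using True by simp
      qed simp
    qed
    finally show ?thesis .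
  qed
  have "exp (h * a) * prob V = (\<Sum>p\<in>Q. exp (h * a) * prob (E p))"
    unfolding V_E using finQ disj by (subst finite_measure_finite_Union) (auto simp: sum_distrib_left)
  also have "\<dots> \<le> (\<Sum>p\<in>Q. expectation (\<lambda>\<omega>. indicator (E p) \<omega> * G \<omega>))"
    by (intro sum_mono EG)
  also have "\<dots> = expectation (\<lambda>\<omega>. \<Sum>p\<in>Q. indicator (E p) \<omega> * G \<omega>)"
    using integrable_mult_indicator[OF E_meas G_int]
    by (subst Bochner_Integration.integral_sum) auto
  also have "\<dots> \<le> expectation G"
  proof (rule integral_mono)
    show "integrable M (\<lambda>\<omega>. \<Sum>p\<in>Q. indicator (E p) \<omega> * G \<omega>)"
      using integrable_mult_indicator[OF E_meas G_int] by (intro Bochner_Integration.integrable_sum) auto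
    fix \<omega>
    \<comment> \<open>The events are disjoint, so their indicators sum to at most 1 and summing over
      \<open>Q\<close> costs nothing.\<close>
    have "(\<Sum>p\<in>Q. indicator (E p) \<omega> * G \<omega>) = indicator (\<Union>p\<in>Q. E p) \<omega> * G \<omega>"
      unfolding sum_distrib_right[symmetric] indicator_UN_disjoint[OF finQ disj] ..
    also have "\<dots> \<le> 1 * G \<omega>"
    proof (rule mult_right_mono)
      show "0 \<le> G \<omega>" unfolding G_def by (intro add_nonneg_nonneg sum_nonneg mult_nonneg_nonneg w) auto
    qed (auto simp: indicator_def)
    finally show "(\<Sum>p\<in>Q. indicator (E p) \<omega> * G \<omega>) \<le> G \<omega>" by simp
  qed simp
  also have "expectation G = 1 + (\<Sum>m=1..n. w m * prob (H m))"
    unfolding G_def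
    by (simp only: Bochner_Integration.integral_add Bochner_Integration.integral_sum
        Bochner_Integration.integrable_sum wH_int integrable_const)
      (simp add: prob_space)
  also have "(\<Sum>m=1..n. w m * prob (H m)) \<le> (\<Sum>m=1..n. w m * (real ((2 * n) choose (n + m)) / real ((2 * n) choose n)))"
    unfolding H_def by (intro sum_mono mult_left_mono w prob_two_sample_ge assms)
  also have "\<dots> = (\<Sum>m=1..n. w m * real ((2 * n) choose (n + m))) / real ((2 * n) choose n)"
    by (simp add: sum_divide_distrib)
  also have "\<dots> \<le> h * 4 ^ n * exp (h\<^sup>2 * real n / 4) / real ((2 * n) choose n)"
    unfolding w_def by (intro divide_right_mono sum_exp_binomial_le h) simp
  \<comment> \<open>The central binomial bound trades 4^n for the denominator, at the price of the
    factor 2 sqrt n.\<close>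
  also have "\<dots> \<le> h * (2 * sqrt (real n) * real ((2 * n) choose n)) * exp (h\<^sup>2 * real n / 4) / real ((2 * n) choose n)"
    by (intro divide_right_mono mult_right_mono mult_left_mono four_power_le_central_binomial h n) auto
  also have "\<dots> = 2 * h * sqrt (real n) * exp (h\<^sup>2 * real n / 4)" by simp
  finally have "exp (h * a) * prob V \<le> 1 + 2 * h * sqrt (real n) * exp (h\<^sup>2 * real n / 4)"
    by simp
  then show ?thesis
    unfolding V_def[symmetric] by (simp add: exp_minus field_simps)
qed

text \<open>The finite bound does not depend on the number of sets, so it passes to an increasing
  union of finite subfamilies.\<close>

lemma prob_sup_dev_ge:
  fixes \<C> :: "'b set set" and n :: nat and a h :: real
  assumes count: "countable \<C>" and meas: "\<C> \<subseteq> sets N"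
    and chain: "\<And>C C'. C \<in> \<C> \<Longrightarrow> C' \<in> \<C> \<Longrightarrow> C \<subseteq> C' \<or> C' \<subseteq> C"
    and n: "n \<ge> 1" and h: "h \<ge> 0"
  shows "{\<omega> \<in> space M. \<exists>t\<in>{1..n}. \<exists>C\<in>\<C>. a \<le> dev t C \<omega>} \<in> events" (is "?V \<C> \<in> _")
    and "prob {\<omega> \<in> space M. \<exists>t\<in>{1..n}. \<exists>C\<in>\<C>. a \<le> dev t C \<omega>}
      \<le> exp (- h * a) * (1 + 2 * h * sqrt (real n) * exp (h\<^sup>2 * real n / 4))" (is "_ \<le> ?B")
proof -
  have V_meas: "?V \<D> \<in> events" if "countable \<D>" "\<D> \<subseteq> sets N" for \<D>
  proof -
    have [measurable]: "C \<in> sets N" if "C \<in> \<D>" for C using \<open>\<D> \<subseteq> sets N\<close> that by auto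
    show ?thesis using \<open>countable \<D>\<close> by measurable
  qed
  show "?V \<C> \<in> events" by (rule V_meas[OF count meas])
  show "prob (?V \<C>) \<le> ?B"
  \<comment> \<open>\<open>from_nat_into\<close> enumerates only nonempty sets; the empty family
    gives the empty event.\<close>
  proof (cases "\<C> = {}")
    case True
    then show ?thesis using h by simp
  next
    case False
    define \<C>' where "\<C>' k = from_nat_into \<C> ` {..k}" for k :: nat
    have sub: "\<C>' k \<subseteq> \<C>" for k
      using from_nat_into[OF False] by (auto simp: \<C>'_def)
    have "(\<Union>k. \<C>' k) = \<C>"
      using from_nat_into_surj[OF count] sub by (fastforce simp: \<C>'_def)
    then have UN: "(\<Union>k. ?V (\<C>' k)) = ?V \<C>" by blast
    have "(\<lambda>k. prob (?V (\<C>' k))) \<longlonglongrightarrow> prob (\<Union>k. ?V (\<C>' k))"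
    proof (rule finite_Lim_measure_incseq)
      show "range (\<lambda>k. ?V (\<C>' k)) \<subseteq> events"
        using sub meas by (intro image_subsetI V_meas) (auto simp: \<C>'_def)
      have "\<C>' k \<subseteq> \<C>' k'" if "k \<le> k'" for k k' using that by (auto simp: \<C>'_def)
      then show "incseq (\<lambda>k. ?V (\<C>' k))" by (intro monoI) blast
    qed
    then have "(\<lambda>k. prob (?V (\<C>' k))) \<longlonglongrightarrow> prob (?V \<C>)" unfolding UN .
    moreover have "prob (?V (\<C>' k)) \<le> ?B" for k
    proof (rule prob_sup_dev_ge_finite[OF _ _ _ n h])
      show "finite (\<C>' k)" by (simp add: \<C>'_def)
      show "\<C>' k \<subseteq> sets N" using sub[of k] meas by blast
    qed (use sub[of k] chain in blast)
    ultimately show ?thesis by (blast intro: LIMSEQ_le_const2)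
  qed
qed

end

section \<open>Epochs of the empirical process\<close>

text \<open>Left half-lines detect an empirical CDF above the true one, right half-lines one below
  it. Each family is a chain, and the union bound gives the factor 2. Rational endpoints make the
  families countable.\<close>

lemma prob_max_sup_norm_ecdf_ge:
  fixes X :: "nat \<Rightarrow> 'a \<Rightarrow> real" and n :: nat and a h :: real
  assumes "iid_sequence M borel P X" and P: "real_distribution P" and n: "n \<ge> 1" and h: "h \<ge> 0"
  shows "measure M {\<omega> \<in> space M. \<exists>t\<in>{1..n}. a \<le> real t * sup_norm (\<lambda>x. ecdf X t \<omega> x - cdf P x)}
    \<le> 2 * (exp (- h * a) * (1 + 2 * h * sqrt (real n) * exp (h\<^sup>2 * real n / 4)))"
proof -
  interpret iid_sequence M borel P X by fact
  interpret P: real_distribution P by fact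
  let ?K = "1 + 2 * h * sqrt (real n) * exp (h\<^sup>2 * real n / 4)"
  let ?W = "{\<omega> \<in> space M. \<exists>t\<in>{1..n}. a \<le> real t * sup_norm (\<lambda>x. ecdf X t \<omega> x - cdf P x)}"
  \<comment> \<open>The supremum need not be attained, so a single endpoint is guaranteed only for
    levels b < a; at the end b tends to a.\<close>
  have bound: "prob ?W \<le> 2 * (exp (- h * b) * ?K)" if b: "b < a" for b
  proof -
    let ?V = "\<lambda>\<C>. {\<omega> \<in> space M. \<exists>t\<in>{1..n}. \<exists>C\<in>\<C>. b \<le> dev t C \<omega>}"
    let ?\<L> = "(\<lambda>q. {..q}) ` \<rat> :: real set set" and ?\<U> = "(\<lambda>q. {q<..}) ` \<rat> :: real set set"
    have L: "?V ?\<L> \<in> events" "prob (?V ?\<L>) \<le> exp (- h * b) * ?K"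
      by (rule prob_sup_dev_ge; use countable_rat n h in fastforce)+
    have U: "?V ?\<U> \<in> events" "prob (?V ?\<U>) \<le> exp (- h * b) * ?K"
      by (rule prob_sup_dev_ge; use countable_rat n h in fastforce)+
    have "?W \<subseteq> ?V ?\<L> \<union> ?V ?\<U>"
    proof
      fix \<omega> assume "\<omega> \<in> ?W"
      then obtain t where \<omega>: "\<omega> \<in> space M" and t: "t \<in> {1..n}"
        and ge: "a \<le> real t * sup_norm (\<lambda>x. ecdf X t \<omega> x - cdf P x)" by auto
      have t0: "real t > 0" using t by simp
      have "b / real t < (SUP x\<in>\<rat>. \<bar>ecdf X t \<omega> x - cdf P x\<bar>)"
        using b ge t0 unfolding sup_norm_eq_SUP_Rats[OF P] by (simp add: field_simps)
      then obtain q where q: "q \<in> \<rat>" "b / real t < \<bar>ecdf X t \<omega> q - cdf P q\<bar>"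
        by (subst (asm) less_cSUP_iff) (use bdd_above_abs_ecdf_diff_cdf[OF P] Rats_0 in auto)
      have low: "dev t {..q} \<omega> = real t * (ecdf X t \<omega> q - cdf P q)"
        using t0 unfolding dev_def ecdf_def cdf_def
        by (simp add: sum_subtractf right_diff_distrib)
      have "measure P {q<..} = 1 - cdf P q"
        using P.prob_compl[of "{..q}"] by (simp add: cdf_def Compl_eq_Diff_UNIV[symmetric] Compl_atMost)
      then have "dev t {q<..} \<omega> = (\<Sum>i=1..t. measure P {..q} - indicator {..q} (X i \<omega>))"
        unfolding dev_def cdf_def by (intro sum.cong) (auto simp: indicator_def)
      then have up: "dev t {q<..} \<omega> = - (real t * (ecdf X t \<omega> q - cdf P q))"
        unfolding low[symmetric] dev_def by (simp add: sum_subtractf)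
      have "b < \<bar>real t * (ecdf X t \<omega> q - cdf P q)\<bar>"
        using q(2) t0 by (simp add: abs_mult pos_divide_less_eq mult.commute)
      then have "b \<le> dev t {..q} \<omega> \<or> b \<le> dev t {q<..} \<omega>"
        unfolding low up by linarith
      then show "\<omega> \<in> ?V ?\<L> \<union> ?V ?\<U>" using \<omega> t q(1) by blast
    qed
    then have "prob ?W \<le> prob (?V ?\<L> \<union> ?V ?\<U>)"
      using L(1) U(1) by (intro finite_measure_mono) auto
    also have "\<dots> \<le> prob (?V ?\<L>) + prob (?V ?\<U>)" using L(1) U(1) by (rule measure_Un_le)
    finally show ?thesis using L(2) U(2) by linarith
  qed
  have "((\<lambda>b. 2 * (exp (- h * b) * ?K)) \<longlongrightarrow> 2 * (exp (- h * a) * ?K)) (at_left a)"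
    by (intro tendsto_intros)
  then show ?thesis
    by (rule tendsto_lowerbound)
      (use bound in \<open>auto simp: eventually_at_left_field intro!: exI[of _ "a - 1"]\<close>)
qed

section \<open>Numerical bounds and thresholds\<close>

text \<open>
  The bound fails for $L$ near $0$ and holds from about $L = 0.36$ on; $0.43$ is the value
  that the weights are shown to guarantee.
\<close>

lemma stitching_numeric_bound:
  fixes L :: real
  assumes L: "L \<ge> 43 / 100"
  defines "A \<equiv> sqrt (pi / 2) + 2 * sqrt L"
  shows "2 * (exp (- A\<^sup>2) * (1 + 2 * sqrt 2 * A * exp (A\<^sup>2 / 2))) \<le> exp (- L)"
proof -
  \<comment> \<open>After multiplication by exp L the claim is 2 exp (L - A^2) + 4 sqrt 2 A exp (L -
    A^2/2) <= 1. The first term is negligible and the second stays below 0.9.\<close>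
  define s r where "s = sqrt (pi / 2)" and "r = sqrt L"
  have pi: "157 / 50 < pi" "pi < 63 / 20" using pi_approx by auto
  have s: "5 / 4 \<le> s" "s \<le> 63 / 50"
    unfolding s_def using pi
    by (intro real_le_rsqrt, simp add: power2_eq_square, intro real_le_lsqrt, simp_all add: power2_eq_square)
  have s2: "39 / 25 \<le> s\<^sup>2" using pi by (simp add: s_def)
  have r: "131 / 200 \<le> r" unfolding r_def using L by (intro real_le_rsqrt) (simp add: power2_eq_square)
  have r2: "r\<^sup>2 = L" "429 / 1000 \<le> r\<^sup>2" using L by (simp_all add: r_def)
  have A: "A = s + 2 * r" by (simp add: A_def s_def r_def)
  have sr: "5 / 4 * r \<le> s * r" using s r by (intro mult_right_mono) auto
  have A2: "A\<^sup>2 = s\<^sup>2 + 4 * (s * r) + 4 * r\<^sup>2" by (simp add: A power2_eq_square algebra_simps)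
  have e1: "(27 / 10 :: real) \<le> exp 1"
  proof -
    \<comment> \<open>The quadratic Taylor polynomial at 1 gives only 2.5; at 1/8 it is accurate
      enough.\<close>
    have "(27 / 10 :: real) \<le> (1 + 1/8 + (1/8)\<^sup>2 / 2) ^ 8" by (simp add: power2_eq_square power_divide eval_nat_numeral)
    also have "\<dots> \<le> exp (1/8) ^ 8"
      by (intro power_mono exp_lower_Taylor_quadratic) auto
    also have "\<dots> = exp (1::real)" by (simp add: exp_of_nat_mult[symmetric])
    finally show ?thesis .
  qed
  have e3: "(98 / 5 :: real) \<le> exp 3"
  proof -
    have "(98 / 5 :: real) \<le> (27 / 10) ^ 3" by (simp add: eval_nat_numeral)
    also have "\<dots> \<le> exp 1 ^ 3" using e1 by (intro power_mono) auto
    also have "\<dots> = exp (3::real)" by (simp add: exp_of_nat_mult[symmetric])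
    finally show ?thesis .
  qed
  have small: "exp (L - A\<^sup>2) \<le> 1 / 384"
  proof -
    have "L - A\<^sup>2 \<le> - 6" using A2 s2 sr r r2 by linarith
    then have "exp (L - A\<^sup>2) \<le> exp (- 6)" by simp
    also have "exp (- 6) = 1 / (exp 3 * exp (3::real))" by (simp add: exp_minus exp_add[symmetric] field_simps)
    also have "\<dots> \<le> 1 / ((98 / 5) * (98 / 5))" using e3 by (intro divide_left_mono mult_mono) auto
    finally show ?thesis by simp
  qed
  \<comment> \<open>The excess of sqrt L over a lower bound. \<open>A\<close> grows linearly in
    \<open>d\<close>, and exp (- 5 d / 2) <= 1 / (1 + 5 d / 2) absorbs this growth, so the estimate
    is uniform in \<open>L\<close>.\<close>
  define d where "d = r - 131 / 200"
  have d: "d \<ge> 0" using r by (simp add: d_def)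
  have main: "A * exp (L - A\<^sup>2 / 2) \<le> (257 / 100) / (82 / 5)"
  proof -
    \<comment> \<open>The exponent equals - s^2/2 - 2 s r - r^2; the constant 4/25 - 3 rounds up its
      estimate at d = 0.\<close>
    have "L - A\<^sup>2 / 2 \<le> 4 / 25 + (- 3 + - (5 / 2 * d))"
    proof -
      have "A\<^sup>2 / 2 = s\<^sup>2 / 2 + 2 * (s * r) + 2 * r\<^sup>2" using A2 by simp
      then show ?thesis using s2 sr r2 unfolding d_def right_diff_distrib by linarith
    qed
    then have "exp (L - A\<^sup>2 / 2) \<le> exp (4 / 25 + (- 3 + - (5 / 2 * d)))" by simp
    also have "\<dots> = exp (4 / 25) * (1 / exp 3) * (1 / exp (5 / 2 * d))"
      by (simp only: exp_add exp_minus inverse_eq_divide mult.assoc)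
    also have "\<dots> \<le> (1 / (21 / 25)) * (1 / (98 / 5)) * (1 / (1 + 5 / 2 * d))"
    proof (intro mult_mono)
      have "21 / 25 \<le> exp (- (4 / 25 :: real))" using exp_ge_add_one_self[of "- (4 / 25 :: real)"] by simp
      then show "exp (4 / 25 :: real) \<le> 1 / (21 / 25)" by (simp add: exp_minus field_simps)
      show "1 / exp (3::real) \<le> 1 / (98 / 5)" using e3 by (intro divide_left_mono) auto
      show "1 / exp (5 / 2 * d) \<le> 1 / (1 + 5 / 2 * d)"
        using d by (intro divide_left_mono exp_ge_add_one_self mult_pos_pos) auto
    qed (use d in auto)
    also have "\<dots> \<le> 1 / (82 / 5) * (1 / (1 + 5 / 2 * d))"
      using d by (intro mult_right_mono) auto
    finally have "exp (L - A\<^sup>2 / 2) \<le> 1 / (82 / 5) * (1 / (1 + 5 / 2 * d))" .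
    moreover have "A \<le> 257 / 100 * (1 + 5 / 2 * d)"
      using s(2) d A unfolding d_def by argo
    ultimately have "A * exp (L - A\<^sup>2 / 2) \<le> (257 / 100 * (1 + 5 / 2 * d)) * (1 / (82 / 5) * (1 / (1 + 5 / 2 * d)))"
      using d by (intro mult_mono) auto
    also have "\<dots> = (257 / 100) / (82 / 5)" using d by (simp add: field_simps)
    finally show ?thesis .
  qed
  have "sqrt 2 \<le> 283 / 200" by (intro real_le_lsqrt) (auto simp: power2_eq_square)
  then have "sqrt 2 * (A * exp (L - A\<^sup>2 / 2)) \<le> (283 / 200) * ((257 / 100) / (82 / 5))"
    using main s r by (intro mult_mono) (auto simp: A)
  then have "2 * exp (L - A\<^sup>2) + 4 * (sqrt 2 * (A * exp (L - A\<^sup>2 / 2))) \<le> 1"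
    using small by simp
  then have "exp (- L) * (2 * exp (L - A\<^sup>2) + 4 * (sqrt 2 * (A * exp (L - A\<^sup>2 / 2)))) \<le> exp (- L) * 1"
    by (intro mult_left_mono) auto
  moreover have "exp (- L) * (2 * exp (L - A\<^sup>2) + 4 * (sqrt 2 * (A * exp (L - A\<^sup>2 / 2))))
    = 2 * exp (- L + (L - A\<^sup>2)) + 4 * sqrt 2 * A * exp (- L + (L - A\<^sup>2 / 2))"
    unfolding exp_add by (simp add: algebra_simps)
  moreover have "\<dots> = 2 * (exp (- A\<^sup>2) * (1 + 2 * sqrt 2 * A * exp (A\<^sup>2 / 2)))"
  proof -
    have "exp (- A\<^sup>2) * exp (A\<^sup>2 / 2) = exp (- A\<^sup>2 / 2)" by (simp add: exp_add[symmetric])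
    then show ?thesis by (simp add: algebra_simps)
  qed
  ultimately show ?thesis by simp
qed

lemma prob_max_sup_norm_ecdf_ge_log:
  fixes X :: "nat \<Rightarrow> 'a \<Rightarrow> real" and n :: nat and L :: real
  assumes iid: "iid_sequence M borel P X" and P: "real_distribution P" and n: "n \<ge> 1" and L: "L \<ge> 43 / 100"
  shows "measure M {\<omega> \<in> space M. \<exists>t\<in>{1..n}.
      sqrt (real n / 2) * (sqrt (pi / 2) + 2 * sqrt L) \<le> real t * sup_norm (\<lambda>x. ecdf X t \<omega> x - cdf P x)}
    \<le> exp (- L)"
proof -
  define A where "A = sqrt (pi / 2) + 2 * sqrt L"
  have A: "A \<ge> 0" using L by (simp add: A_def)
  \<comment> \<open>This \<open>h\<close> minimises - h a + h^2 n / 4 at the level a = sqrt (n/2) A,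
    where the minimum is - A^2/2.\<close>
  define h where "h = sqrt 2 * A / sqrt (real n)"
  have h: "h \<ge> 0" using A by (simp add: h_def)
  have "h * (sqrt (real n / 2) * A) = A\<^sup>2"
    using n by (simp add: h_def real_sqrt_divide power2_eq_square)
  then have 1: "- h * (sqrt (real n / 2) * A) = - A\<^sup>2" by simp
  have 2: "2 * h * sqrt (real n) = 2 * sqrt 2 * A" using n by (simp add: h_def)
  have 3: "h\<^sup>2 * real n / 4 = A\<^sup>2 / 2" using n by (simp add: h_def power_divide power_mult_distrib)
  show ?thesis
    using prob_max_sup_norm_ecdf_ge[OF iid P n h, of "sqrt (real n / 2) * A"] stitching_numeric_bound[OF L]
    unfolding 1 2 3 A_def[symmetric] by linarith
qed

lemma ln_weight_ge:
  fixes l :: "real \<Rightarrow> real"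
  assumes l_ge_1: "\<And>x. x \<ge> 0 \<Longrightarrow> l x \<ge> 1"
    and l_summable: "summable (\<lambda>k. 1 / l (real (Suc k)))"
    and l_sum: "(\<Sum>k. 1 / l (real (Suc k))) \<le> 1"
    and l_decreasing: "antimono_on {1..} (\<lambda>u. 2 powr (- u) * ln (l u))"
  shows "43 / 100 \<le> ln (l (real (Suc k)))"
  \<comment> \<open>otherwise $\ell(k+1) \le \ell(k)^2$ makes two consecutive terms of the series sum to more than $1$\<close>
proof (rule ccontr)
  let ?b = "\<lambda>k. l (real (Suc k))"
  assume "\<not> ?thesis"
  then have lt: "ln (?b k) < 43 / 100" by simp
  have b: "?b i \<ge> 1" for i by (rule l_ge_1) simp
  have "2 powr (- real (Suc (Suc k))) * ln (?b (Suc k)) \<le> 2 powr (- real (Suc k)) * ln (?b k)"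
    by (rule monotone_onD[OF l_decreasing]) auto
  also have "2 powr (- real (Suc (Suc k))) = 2 powr (- real (Suc k)) / 2"
    using powr_diff[of 2 "- real (Suc k)" 1] by (simp add: algebra_simps)
  finally have "ln (?b (Suc k)) \<le> 2 * ln (?b k)" by simp
  then have le: "ln (?b (Suc k)) \<le> 43 / 100 + 43 / 100" using lt by simp
  \<comment> \<open>The bound 1 + x + x^2 at x = 0.43 is 1.6149, still below the golden ratio, the
    positive root of 1/y + 1/y^2 = 1.\<close>
  have e: "exp (43 / 100 :: real) \<le> 1.6149" using exp_bound[of "43 / 100"] by (simp add: power2_eq_square)
  have "?b k = exp (ln (?b k))" using b[of k] by simp
  also have "\<dots> \<le> exp (43 / 100)" using lt by simp
  finally have b0: "?b k \<le> 1.6149" using e by simp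
  have "?b (Suc k) = exp (ln (?b (Suc k)))" using b[of "Suc k"] by simp
  also have "\<dots> \<le> exp (43 / 100) * exp (43 / 100)" using le by (simp add: exp_add[symmetric])
  also have "\<dots> \<le> 1.6149 * 1.6149" using e by (intro mult_mono) auto
  finally have b1: "?b (Suc k) \<le> 2.61" by simp
  have "10000 / 16149 \<le> 1 / ?b k" "100 / 261 \<le> 1 / ?b (Suc k)"
    using b0 b1 b[of k] b[of "Suc k"] by (auto simp: field_simps simp del: of_nat_Suc)
  then have "1 < 1 / ?b k + 1 / ?b (Suc k)" by linarith
  also have "\<dots> = (\<Sum>i\<in>{k, Suc k}. 1 / ?b i)" by simp
  also have "\<dots> \<le> (\<Sum>k. 1 / ?b k)"
    using l_summable by (rule sum_le_suminf) (use b order_trans[OF zero_le_one] in auto)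
  finally show False using l_sum by simp
qed

text \<open>The left side is n/2 times sqrt (pi/n) + 2 sqrt (2 L/n). Passing from n to t increases
  both factors, as n/2 <= t and the radicands grow. Thus one constant level lies below the moving
  boundary throughout an epoch.\<close>

lemma threshold_mono:
  fixes t n :: nat and L B :: real
  assumes L: "L \<ge> 0" and t: "t \<ge> 1" "t \<le> n" "real n \<le> 2 * real t" and LB: "L / real n \<le> B / real t"
  shows "sqrt (real n / 2) * (sqrt (pi / 2) + 2 * sqrt L)
    \<le> real t * (sqrt (pi / real t) + 2 * sqrt (2 / real t * B))"
proof -
  have n: "real n > 0" using t by simp
  have sq: "sqrt (real n / 2) * x = real n / 2 * (sqrt (2 / real n) * x)" for x
  proof -
    have "sqrt (real n / 2) = real n / 2 * sqrt (2 / real n)"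
      using n by (intro real_sqrt_unique) (auto simp: power_mult_distrib power2_eq_square)
    then show ?thesis by simp
  qed
  have "sqrt (2 / real n) * (sqrt (pi / 2) + 2 * sqrt L) = sqrt (pi / real n) + 2 * sqrt (2 * (L / real n))"
    by (simp add: distrib_left real_sqrt_mult[symmetric] mult.left_commute)
  also have "\<dots> \<le> sqrt (pi / real t) + 2 * sqrt (2 * (B / real t))"
    using t LB by (intro add_mono mult_left_mono real_sqrt_le_mono divide_left_mono) auto
  finally have le: "sqrt (2 / real n) * (sqrt (pi / 2) + 2 * sqrt L)
    \<le> sqrt (pi / real t) + 2 * sqrt (2 / real t * B)" by simp
  have "0 \<le> sqrt (2 / real n) * (sqrt (pi / 2) + 2 * sqrt L)" using L by simp
  with le show ?thesis unfolding sq using t by (intro mult_mono) auto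
qed

theorem corollary4:
  fixes M :: "'a measure" and P :: "real measure"
    and X :: "nat \<Rightarrow> 'a \<Rightarrow> real" and l :: "real \<Rightarrow> real" and \<delta> :: real
  assumes "prob_space M"
    and "real_distribution P"
    and indep: "prob_space.indep_vars M (\<lambda>_. borel) X {1..}"
    and ident: "\<And>i. i \<ge> 1 \<Longrightarrow> distr M borel (X i) = P"
    and l_ge_1: "\<And>x. x \<ge> 0 \<Longrightarrow> l x \<ge> 1"
    and l_summable: "summable (\<lambda>k. 1 / l (real (Suc k)))"
    and l_sum: "(\<Sum>k. 1 / l (real (Suc k))) \<le> 1"
    and l_const: "\<And>x. x \<in> {0..1} \<Longrightarrow> l x = l 1"
    and l_decreasing: "antimono_on {1..} (\<lambda>u. 2 powr (- u) * ln (l u))"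
    and \<delta>: "\<delta> \<in> {0<..<1}"
  shows "measure M {\<omega> \<in> space M. \<exists>t\<ge>1.
      sup_norm (\<lambda>x. ecdf X t \<omega> x - cdf P x) \<ge>
        sqrt (pi / real t) + 2 * sqrt (2 / real t * (ln (l (log 2 (real t))) + ln (1 / \<delta>)))} \<le> \<delta>"
proof -
  interpret prob_space M by fact
  have iid: "iid_sequence M borel P X"
    by (intro iid_sequence.intro iid_sequence_axioms.intro indep ident) unfold_locales
  have X: "X i \<in> borel_measurable M" if "i \<in> {1..}" for i
    using indep that by (auto simp: indep_vars_def)
  define D where "D t \<omega> = sup_norm (\<lambda>x. ecdf X t \<omega> x - cdf P x)" for t \<omega>
  define c where "c t = sqrt (pi / real t) + 2 * sqrt (2 / real t * (ln (l (log 2 (real t))) + ln (1 / \<delta>)))" for t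
  define L where "L j = ln (l (real (Suc j))) + ln (1 / \<delta>)" for j
  define a where "a j = sqrt (real (2 ^ Suc j) / 2) * (sqrt (pi / 2) + 2 * sqrt (L j))" for j
  \<comment> \<open>The moving boundary in epoch \<open>j\<close> is replaced by the constant level
    \<open>a j\<close>. \<open>L j\<close> is chosen so that exp (- L j) is the share \<delta> / l
    (j + 1) of the error budget.\<close>
  define W where "W j = {\<omega> \<in> space M. \<exists>t\<in>{1..2 ^ Suc j}. a j \<le> real t * D t \<omega>}" for j
  have ln_\<delta>: "ln (1 / \<delta>) \<ge> 0" using \<delta> by simp
  have L: "L j \<ge> 43 / 100" for j
    using ln_weight_ge[OF l_ge_1 l_summable l_sum l_decreasing, of j] ln_\<delta> by (simp add: L_def)
  have [measurable]: "D t \<in> borel_measurable M" for t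
    unfolding D_def by (rule borel_measurable_sup_norm_ecdf[OF assms(2)]) (use X in auto)
  have W_meas: "W j \<in> events" for j unfolding W_def by measurable
  have W_prob: "prob (W j) \<le> \<delta> * (1 / l (real (Suc j)))" for j
  proof -
    have "prob (W j) \<le> exp (- L j)"
      unfolding W_def a_def D_def
      using prob_max_sup_norm_ecdf_ge_log[OF iid assms(2) _ L[of j], of "2 ^ Suc j"] by simp
    also have "exp (- L j) = \<delta> * (1 / l (real (Suc j)))"
      using l_ge_1[of "real (Suc j)"] \<delta> by (simp add: L_def exp_diff ln_div field_simps)
    finally show ?thesis .
  qed
  have cover: "{\<omega> \<in> space M. \<exists>t\<ge>1. c t \<le> D t \<omega>} \<subseteq> (\<Union>j. W j)"
  proof
    fix \<omega> assume "\<omega> \<in> {\<omega> \<in> space M. \<exists>t\<ge>1. c t \<le> D t \<omega>}"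
    then obtain t :: nat where \<omega>: "\<omega> \<in> space M" and t: "t \<ge> 1" and ge: "c t \<le> D t \<omega>" by auto
    obtain j where j: "2 ^ j \<le> t" "t < 2 ^ Suc j"
      using ex_power_ivl1[of 2 t] t by auto
    define u where "u = log 2 (real t)"
    have tu: "real t = 2 powr u" using t by (simp add: u_def)
    have pw: "real (2 ^ Suc j) = 2 powr real (Suc j)" by (simp only: powr_realpow[symmetric] of_nat_power of_nat_numeral)
    have "2 powr u \<le> 2 powr real (Suc j)"
      unfolding tu[symmetric] pw[symmetric] using j(2) by (simp only: of_nat_le_iff less_imp_le)
    then have uj: "u \<le> real (Suc j)" by (simp only: powr_le_cancel_iff)
    \<comment> \<open>With u = log 2 t, the factors 2^(-u) and 2^(-(j+1)) are the reciprocals of t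
      and of the end of the epoch.\<close>
    have ln_l: "ln (l (real (Suc j))) / real (2 ^ Suc j) \<le> ln (l u) / real t"
    proof (cases "u \<ge> 1")
      case True
      have "2 powr (- real (Suc j)) * ln (l (real (Suc j))) \<le> 2 powr (- u) * ln (l u)"
        by (rule monotone_onD[OF l_decreasing]) (use True uj in auto)
      then show ?thesis unfolding pw tu powr_minus_divide by simp
    next
      \<comment> \<open>Monotonicity is given only from 1 on. Here t = 1, u = 0 and j = 0, and
        constancy on [0, 1] identifies \<open>l 0\<close> with \<open>l 1\<close>.\<close>
      case False
      then have "t < 2" using tu t powr_less_cancel_iff[of 2 u 1] by simp
      then have "t = 1" using t by simp
      moreover have "j = 0" using j(1) \<open>t = 1\<close> power_eq_1_iff[of "2::nat" j] by (simp add: le_Suc_eq)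
      ultimately have "t = 1" "j = 0" .
      then show ?thesis
        using l_const[of 0] l_ge_1[of 1] by (simp add: u_def)
    qed
    have "L j / real (2 ^ Suc j) \<le> (ln (l u) + ln (1 / \<delta>)) / real t"
      unfolding L_def add_divide_distrib
      using ln_\<delta> j t by (intro add_mono ln_l divide_left_mono) (auto simp flip: of_nat_power)
    then have "a j \<le> real t * c t"
      unfolding a_def c_def u_def[symmetric] using j t order_trans[OF _ L[of j], of 0]
      by (intro threshold_mono) (auto simp flip: of_nat_power of_nat_mult)
    also have "\<dots> \<le> real t * D t \<omega>" using ge by (intro mult_left_mono) auto
    finally have "\<omega> \<in> W j" using \<omega> t j by (auto simp: W_def)
    then show "\<omega> \<in> (\<Union>j. W j)" by blast
  qed
  \<comment> \<open>Established first, so that the \<open>suminf\<close> of the probabilities is a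
    genuine sum.\<close>
  have W_summable: "summable (\<lambda>j. prob (W j))"
    using W_prob by (intro summable_comparison_test'[OF summable_mult[OF l_summable, of \<delta>]]) auto
  have "prob {\<omega> \<in> space M. \<exists>t\<ge>1. c t \<le> D t \<omega>} \<le> prob (\<Union>j. W j)"
    using W_meas cover by (intro finite_measure_mono) auto
  also have "\<dots> \<le> (\<Sum>j. prob (W j))"
    using W_meas W_summable by (intro finite_measure_subadditive_countably) auto
  also have "\<dots> \<le> (\<Sum>j. \<delta> * (1 / l (real (Suc j))))"
    using W_prob by (intro suminf_le W_summable summable_mult l_summable) auto
  also have "\<dots> = \<delta> * (\<Sum>j. 1 / l (real (Suc j)))" by (rule suminf_mult[OF l_summable])
  also have "\<dots> \<le> \<delta> * 1" using l_sum \<delta> by (intro mult_left_mono) auto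
  finally show ?thesis by (simp add: c_def D_def)
qed

end
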